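(* Let $A$ be an abelian group and let $X$ be a proper metric space, viewed as a bornological coarse space with the coarse structure and bornology induced by the metric. Then the natural morphism $$\iota\, C\mathcal{X}_{Roe}(X;A)\to H\!A\mathcal{X}(X)$$ is an equivalence in $\mathbf{Ch}_\infty$.
   Context: $\iota\colon\mathbf{Ch}\to\mathbf{Ch}_\infty$ is the Dwyer–Kan localization of the category of chain complexes of abelian groups at the quasi-isomorphisms. For a metric space $(X,d)$ the entourages are the subsets of $X\times X$ contained in $U_r:=\{(x,y)\in X\times X\mid d(x,y)<r\}$ for some $r>0$, and the bounded subsets are the metrically bounded ones. The metric space is proper if all closed bounded subsets are compact. Let $\mathcal{C}$ be the coarse structure (set of entourages). For an entourage $U$ of $X$ containing the diagonal let $\hat X_U[n]$ be the set of tuples $(x_0,\dots,x_n)\in X^{n+1}$ with $(x_i,x_j)\in U$ for all $i,j$. Let $C_U(X;A)$ be the complex which in degree $n\geq0$ consists of all functions $\phi\colon\hat X_U[n]\to A$ for which there is a bounded $B\subseteq X$ with $\phi(x_0,\dots,x_n)=0$ unless $x_i\in B$ for all $i$; the differential $C^n\to C^{n+1}$ is $d=\sum_{i=0}^{n+1}(-1)^id_i$, where $d_i$ is pull-back along the map omitting $x_i$. Coarse ordinary cohomology is $H\!A\mathcal{X}(X)\simeq\lim_{U\in\mathcal{C}}\iota C_U(X;A)$, with the limit taken in $\mathbf{Ch}_\infty$ along the restriction maps. Roe's complex $C\mathcal{X}_{Roe}(X;A)$ consists in degree $n\geq0$ of the locally bounded Borel functions $\phi\colon X^{n+1}\to A$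 such that for every $r>0$ the restriction of $\phi$ to $\hat X_{U_r}[n]$ has bounded support (vanishes on tuples not contained in some bounded $B=B(r)$), with the same differential. Equivalently, it is the limit in $\mathbf{Ch}$ over entourages $U$ of the subcomplexes $C_{U,Roe}(X;A)\subseteq C_U(X;A)$ of locally bounded Borel functions. Here $A$ is regarded as a discrete group, and a function is locally bounded if every point has a neighbourhood on which it takes only finitely many values. The natural morphism is induced by the restrictions $C\mathcal{X}_{Roe}(X;A)\to C_U(X;A)$. *)

theory Defs
  imports "HOL-Analysis.Analysis" "HOL-Library.Function_Algebras"
begin

section \<open>Cochain complexes of abelian groups\<close>

text \<open>Nonnegatively graded cochain complexes. The group in each degree is a subgroup of an ambient
  type of class \<^class>\<open>ab_group_add\<close>. All complexes below consist of functions, with the pointwise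
  group structure; a function on a subset of a type is represented by its extension by zero.\<close>

record 'g complex_of_groups =
  Coch :: "nat \<Rightarrow> 'g set"
  Diff :: "nat \<Rightarrow> 'g \<Rightarrow> 'g"

definition additive_subgroup :: "'g::ab_group_add set \<Rightarrow> bool" where
  "additive_subgroup S \<longleftrightarrow> 0 \<in> S \<and> (\<forall>a\<in>S. \<forall>b\<in>S. a - b \<in> S)"

definition cochain_complex :: "'g::ab_group_add complex_of_groups \<Rightarrow> bool" where
  "cochain_complex C \<longleftrightarrow> (\<forall>n.
      additive_subgroup (Coch C n) \<and>
      Diff C n ` Coch C n \<subseteq> Coch C (Suc n) \<and>
      (\<forall>a\<in>Coch C n. \<forall>b\<in>Coch C n. Diff C n (a + b) = Diff C n a + Diff C n b) \<and>
      (\<forall>a\<in>Coch C n. Diff C (Suc n) (Diff C n a) = 0))"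

definition cochain_map ::
  "(nat \<Rightarrow> 'g \<Rightarrow> 'h) \<Rightarrow> 'g::ab_group_add complex_of_groups \<Rightarrow> 'h::ab_group_add complex_of_groups \<Rightarrow> bool"
where
  "cochain_map f C D \<longleftrightarrow> (\<forall>n.
      f n ` Coch C n \<subseteq> Coch D n \<and>
      (\<forall>a\<in>Coch C n. \<forall>b\<in>Coch C n. f n (a + b) = f n a + f n b) \<and>
      (\<forall>a\<in>Coch C n. f (Suc n) (Diff C n a) = Diff D n (f n a)))"

definition cocycles :: "'g::ab_group_add complex_of_groups \<Rightarrow> nat \<Rightarrow> 'g set" where
  "cocycles C n = {a \<in> Coch C n. Diff C n a = 0}"

definition coboundaries :: "'g::ab_group_add complex_of_groups \<Rightarrow> nat \<Rightarrow> 'g set" where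
  "coboundaries C n = (case n of 0 \<Rightarrow> {0} | Suc k \<Rightarrow> Diff C k ` Coch C k)"

definition cohomologous :: "'g::ab_group_add complex_of_groups \<Rightarrow> nat \<Rightarrow> ('g \<times> 'g) set" where
  "cohomologous C n = {(a, b). a \<in> cocycles C n \<and> b \<in> cocycles C n \<and> a - b \<in> coboundaries C n}"

definition cohomology :: "'g::ab_group_add complex_of_groups \<Rightarrow> nat \<Rightarrow> 'g set set" where
  "cohomology C n = cocycles C n // cohomologous C n"

text \<open>The map \<open>[a] \<mapsto> [f a]\<close> on cohomology classes, in the codomain complex \<open>D\<close>.\<close>

definition cohomology_map ::
  "(nat \<Rightarrow> 'g \<Rightarrow> 'h) \<Rightarrow> 'h::ab_group_add complex_of_groups \<Rightarrow> nat \<Rightarrow> 'g set \<Rightarrow> 'h set"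
where
  "cohomology_map f D n c = cohomologous D n `` (f n ` c)"

definition quasi_isomorphism ::
  "(nat \<Rightarrow> 'g \<Rightarrow> 'h) \<Rightarrow> 'g::ab_group_add complex_of_groups \<Rightarrow> 'h::ab_group_add complex_of_groups \<Rightarrow> bool"
where
  "quasi_isomorphism f C D \<longleftrightarrow>
     cochain_complex C \<and> cochain_complex D \<and> cochain_map f C D \<and>
     (\<forall>n. bij_betw (cohomology_map f D n) (cohomology C n) (cohomology D n))"

section \<open>Alternating sums and omission of entries\<close>

definition alt :: "nat \<Rightarrow> 'g::ab_group_add \<Rightarrow> 'g" where
  "alt i a = (if even i then a else - a)"

definition omit :: "nat \<Rightarrow> 'b list \<Rightarrow> 'b list" where
  "omit i xs = take i xs @ drop (Suc i) xs"

section \<open>Limits in the derived \<open>\<infinity>\<close>-category of chain complexes\<close>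

text \<open>Let \<open>F\<close> be a contravariant diagram of cochain complexes indexed by the subset \<open>I\<close> of a partially
  ordered type, with structure maps \<open>res V U : F V \<rightarrow> F U\<close> for \<open>U \<le> V\<close>. Every complex of abelian
  groups is fibrant and products of complexes preserve quasi-isomorphisms, so the limit of \<open>F\<close> in the
  Dwyer--Kan localization at the quasi-isomorphisms is represented by the homotopy limit of
  Bousfield and Kan: the product total complex of the cosimplicial replacement
  \[ [p] \mapsto \prod_{U_0 \le \dots \le U_p} F(U_0). \]
  An element of total degree \<open>m\<close> assigns to a chain \<open>[U\<^sub>0, \<dots>, U\<^sub>p]\<close> with \<open>p \<le> m\<close> an element of degree
  \<open>m - p\<close> of \<open>F U\<^sub>0\<close>. Since the diagram is contravariant, it is the face omitting \<open>U\<^sub>0\<close> which involves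
  a structure map. The differential of the total complex is the sum of the cosimplicial differential
  and \<open>(-1)\<^sup>p\<close> times the differential of \<open>F U\<^sub>0\<close>.\<close>

definition chain_list :: "'i::order set \<Rightarrow> 'i list \<Rightarrow> bool" where
  "chain_list I s \<longleftrightarrow> s \<noteq> [] \<and> set s \<subseteq> I \<and> sorted_wrt (\<le>) s"

definition holim_coch ::
  "'i::order set \<Rightarrow> ('i \<Rightarrow> 'g::ab_group_add complex_of_groups) \<Rightarrow> nat \<Rightarrow> ('i list \<Rightarrow> 'g) set"
where
  "holim_coch I F m = {c. \<forall>s.
     (if chain_list I s \<and> length s \<le> Suc m
      then c s \<in> Coch (F (hd s)) (Suc m - length s)
      else c s = 0)}"

definition holim_diff ::
  "'i::order set \<Rightarrow> ('i \<Rightarrow> 'g::ab_group_add complex_of_groups) \<Rightarrow> ('i \<Rightarrow> 'i \<Rightarrow> nat \<Rightarrow> 'g \<Rightarrow> 'g) \<Rightarrow>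
     nat \<Rightarrow> ('i list \<Rightarrow> 'g) \<Rightarrow> ('i list \<Rightarrow> 'g)"
where
  "holim_diff I F res m c = (\<lambda>s.
     if chain_list I s \<and> length s \<le> Suc (Suc m) then
       (let p = length s - 1 in
          (if 1 \<le> p
           then res (s ! 1) (s ! 0) (Suc m - p) (c (omit 0 s)) + (\<Sum>i=1..p. alt i (c (omit i s)))
           else 0)
        + (if p \<le> m then alt p (Diff (F (hd s)) (m - p) (c s)) else 0))
     else 0)"

definition holim ::
  "'i::order set \<Rightarrow> ('i \<Rightarrow> 'g::ab_group_add complex_of_groups) \<Rightarrow> ('i \<Rightarrow> 'i \<Rightarrow> nat \<Rightarrow> 'g \<Rightarrow> 'g) \<Rightarrow>
     ('i list \<Rightarrow> 'g) complex_of_groups"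
where
  "holim I F res = \<lparr>Coch = holim_coch I F, Diff = holim_diff I F res\<rparr>"

text \<open>The map into the limit induced by a strict cone \<open>r U : C \<rightarrow> F U\<close>; it is concentrated in
  cosimplicial degree \<open>p = 0\<close>.\<close>

definition holim_lift ::
  "'i::order set \<Rightarrow> ('i \<Rightarrow> nat \<Rightarrow> 'g \<Rightarrow> 'h::ab_group_add) \<Rightarrow> nat \<Rightarrow> 'g \<Rightarrow> ('i list \<Rightarrow> 'h)"
where
  "holim_lift I r n a = (\<lambda>s. if length s = 1 \<and> hd s \<in> I then r (hd s) n a else 0)"

section \<open>Coarse cohomology of a metric space\<close>

context Metric_space
begin

definition proper_metric :: bool where
  "proper_metric \<longleftrightarrow> (\<forall>S. closedin mtopology S \<and> mbounded S \<longrightarrow> compactin mtopology S)"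

definition strip :: "real \<Rightarrow> ('a \<times> 'a) set" where
  "strip r = {(x, y) \<in> M \<times> M. d x y < r}"

definition entourages :: "('a \<times> 'a) set set" where
  "entourages = {U. \<exists>r>0. U \<subseteq> strip r}"

definition full_entourages :: "('a \<times> 'a) set set" where
  "full_entourages = {U \<in> entourages. Id_on M \<subseteq> U}"

text \<open>Points \<open>(x\<^sub>0, \<dots>, x\<^sub>n)\<close> of \<open>M\<^sup>n\<^sup>+\<^sup>1\<close> are lists of length \<open>n + 1\<close>.\<close>

definition tuples :: "nat \<Rightarrow> 'a list set" where
  "tuples n = {xs. length xs = Suc n \<and> set xs \<subseteq> M}"

definition controlled_tuples :: "('a \<times> 'a) set \<Rightarrow> nat \<Rightarrow> 'a list set" where
  "controlled_tuples U n = {xs \<in> tuples n. \<forall>i\<le>n. \<forall>j\<le>n. (xs ! i, xs ! j) \<in> U}"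

definition tuple_topology :: "nat \<Rightarrow> 'a list topology" where
  "tuple_topology n =
     pullback_topology (tuples n) (\<lambda>xs. \<lambda>i\<in>{..n}. xs ! i) (product_topology (\<lambda>_. mtopology) {..n})"

definition tuple_borel :: "nat \<Rightarrow> 'a list measure" where
  "tuple_borel n = sigma (tuples n) {W. openin (tuple_topology n) W}"

definition bounded_support_on :: "'a list set \<Rightarrow> ('a list \<Rightarrow> 'b::ab_group_add) \<Rightarrow> bool" where
  "bounded_support_on T \<phi> \<longleftrightarrow> (\<exists>B\<subseteq>M. mbounded B \<and> (\<forall>xs\<in>T. \<not> set xs \<subseteq> B \<longrightarrow> \<phi> xs = 0))"

definition tuple_diff :: "'a list set \<Rightarrow> nat \<Rightarrow> ('a list \<Rightarrow> 'b::ab_group_add) \<Rightarrow> ('a list \<Rightarrow> 'b)" where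
  "tuple_diff T n \<phi> = (\<lambda>xs. if xs \<in> T then (\<Sum>i\<le>Suc n. alt i (\<phi> (omit i xs))) else 0)"

definition restrict_tuples :: "'a list set \<Rightarrow> ('a list \<Rightarrow> 'b::ab_group_add) \<Rightarrow> ('a list \<Rightarrow> 'b)" where
  "restrict_tuples T \<phi> = (\<lambda>xs. if xs \<in> T then \<phi> xs else 0)"

text \<open>The coefficient group \<open>A\<close> is the type \<open>'b\<close>.\<close>

definition controlled_complex ::
  "('a \<times> 'a) set \<Rightarrow> ('a list \<Rightarrow> 'b::ab_group_add) complex_of_groups" where
  "controlled_complex U =
     \<lparr>Coch = (\<lambda>n. {\<phi>. (\<forall>xs. xs \<notin> controlled_tuples U n \<longrightarrow> \<phi> xs = 0) \<and>
                       bounded_support_on (controlled_tuples U n) \<phi>}),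
      Diff = (\<lambda>n. tuple_diff (controlled_tuples U (Suc n)) n)\<rparr>"

definition coarse_cohomology_complex ::
  "(('a \<times> 'a) set list \<Rightarrow> 'a list \<Rightarrow> 'b::ab_group_add) complex_of_groups" where
  "coarse_cohomology_complex =
     holim full_entourages controlled_complex (\<lambda>V U n. restrict_tuples (controlled_tuples U n))"

definition locally_bounded :: "nat \<Rightarrow> ('a list \<Rightarrow> 'b) \<Rightarrow> bool" where
  "locally_bounded n \<phi> \<longleftrightarrow>
     (\<forall>xs\<in>tuples n. \<exists>W. openin (tuple_topology n) W \<and> xs \<in> W \<and> finite (\<phi> ` W))"

text \<open>\<^term>\<open>count_space UNIV\<close> carries the Borel sets of the discrete group \<open>A\<close>.\<close>

definition roe_complex :: "('a list \<Rightarrow> 'b::ab_group_add) complex_of_groups" where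
  "roe_complex =
     \<lparr>Coch = (\<lambda>n. {\<phi>. (\<forall>xs. xs \<notin> tuples n \<longrightarrow> \<phi> xs = 0) \<and>
                       \<phi> \<in> measurable (tuple_borel n) (count_space UNIV) \<and>
                       locally_bounded n \<phi> \<and>
                       (\<forall>r>0. bounded_support_on (controlled_tuples (strip r) n) \<phi>)}),
      Diff = (\<lambda>n. tuple_diff (tuples (Suc n)) n)\<rparr>"

definition roe_comparison ::
  "nat \<Rightarrow> ('a list \<Rightarrow> 'b::ab_group_add) \<Rightarrow> (('a \<times> 'a) set list \<Rightarrow> 'a list \<Rightarrow> 'b)" where
  "roe_comparison = holim_lift full_entourages (\<lambda>U n. restrict_tuples (controlled_tuples U n))"

end

end

theory Submission
  imports Defs
begin

text \<open>
  Let \<open>L\<close> be the strict limit of the complexes of controlled cochains: all functions on tuples whose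
  restriction to every strip has bounded support, Borel or not (\<open>limit_coch\<close>). The comparison map
  factors through \<open>L\<close>, and both factors are quasi-isomorphisms.

  From Roe's complex to \<open>L\<close>. A proper metric space has a Borel self-map \<open>f\<close> which moves points by less
  than one and takes finitely many values on each bounded set (\<open>ex_discretization\<close>). Precomposition with
  \<open>f\<close> makes every cochain Borel and locally bounded, since \<open>\<phi> \<circ> f\<close> is locally determined by
  finitely many points. The prism operator \<open>P\<close> of \<open>f\<close> is a homotopy between the identity and
  precomposition with \<open>f\<close>. It acts on \<open>L\<close> because \<open>f\<close> moves points by a bounded amount, and it acts
  on Roe's complex because \<open>f\<close> is Borel with countable range. So the inclusion of Roe's complex into
  \<open>L\<close> is a homotopy equivalence. The form used is \<open>roe_approximation\<close>.

  From \<open>L\<close> to the homotopy limit. The homotopy limit is the total complex of a double complex, and it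
  suffices that the complexes in the direction of the chains of entourages are resolutions of \<open>L\<close>.
  For a fixed tuple \<open>xs\<close> a cochain is a function of chains in the set of entourages containing all pairs
  of entries of \<open>xs\<close>. This poset has a least element, and putting it in front of a chain is a
  contraction, but applied to all tuples at once it destroys the bounded supports: infinitely many
  entourages would be put in front of the same chain. Therefore an entourage \<open>W\<close> is first replaced by the
  smallest strip \<open>hull W\<close> of positive integral width that contains it (\<open>strip_hull\<close>). Since \<open>hull\<close> is
  monotone and \<open>W \<subseteq> hull W\<close>, the prism operator of \<open>hull\<close> is a homotopy from the identity to the operation
  induced by \<open>hull\<close>. After this replacement \<open>hull\<close> of the set of pairs of \<open>xs\<close> can be put in front,
  and among the tuples controlled by a given entourage it takes finitely many values only
  (\<open>cone_homotopy\<close>, \<open>contraction_in_Coch\<close>). As the chains in a cochain of given total degree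
  have bounded length, finitely many such corrections remove all components on chains with two or more
  entries (\<open>staircase\<close>). The component that remains does not depend on the entourage and is an element
  of \<open>L\<close> (\<open>concentrated_cochain_is_limit\<close>).

  Tuples and chains are both lists, and the two prism operators are instances of one construction,
  whose homotopy formula is an induction on lists (\<open>prism_homotopy\<close>).
\<close>

section \<open>Alternating sums over faces and the prism homotopy\<close>

lemma alt_0 [simp]: "alt 0 a = a"
  by (simp add: alt_def)

lemma alt_Suc [simp]: "alt (Suc i) a = - alt i a"
  by (simp add: alt_def)

lemma alt_zero [simp]: "alt i 0 = 0"
  by (simp add: alt_def)

lemma alt_eq_0_iff [simp]: "alt i a = 0 \<longleftrightarrow> a = 0"
  by (simp add: alt_def)

lemma alt_add: "alt i (a + b) = alt i a + alt i b"
  by (simp add: alt_def)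

lemma alt_minus: "alt i (- a) = - alt i a"
  by (simp add: alt_def)

lemma alt_diff: "alt i (a - b) = alt i a - alt i b"
  by (simp add: alt_def)

lemma alt_sum: "alt i (sum g A) = (\<Sum>a\<in>A. alt i (g a))"
  by (simp add: alt_def sum_negf)

lemma alt_commute: "alt i (alt j a) = alt j (alt i a)"
  by (simp add: alt_def)

lemma alt_fun_apply: "alt i g x = alt i (g x)"
  by (simp add: alt_def)

lemma sum_fun_apply: "sum g A x = (\<Sum>a\<in>A. g a x)"
  by (induction A rule: infinite_finite_induct) auto

lemma omit_0_Cons [simp]: "omit 0 (x # xs) = xs"
  by (simp add: omit_def)

lemma omit_Suc_Cons [simp]: "omit (Suc i) (x # xs) = x # omit i xs"
  by (simp add: omit_def)

lemma length_omit: "i < length xs \<Longrightarrow> length (omit i xs) = length xs - 1"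
  by (simp add: omit_def)

lemma set_omit_subset: "set (omit i xs) \<subseteq> set xs"
  by (auto simp: omit_def dest: in_set_takeD in_set_dropD)

lemma omit_map: "omit i (map f xs) = map f (omit i xs)"
  by (simp add: omit_def take_map drop_map)

definition face_sum :: "('b list \<Rightarrow> 'g::ab_group_add) \<Rightarrow> 'b list \<Rightarrow> 'g" where
  "face_sum g xs = (\<Sum>i<length xs. alt i (g (omit i xs)))"

lemma face_sum_Nil [simp]: "face_sum g [] = 0"
  by (simp add: face_sum_def)

lemma face_sum_Cons: "face_sum g (x # xs) = g xs - face_sum (\<lambda>ys. g (x # ys)) xs"
  unfolding face_sum_def by (simp add: sum.lessThan_Suc_shift sum_negf del: sum.lessThan_Suc)

lemma face_sum_map: "face_sum g (map f xs) = face_sum (\<lambda>ys. g (map f ys)) xs"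
  by (simp add: face_sum_def omit_map)

lemma face_sum_add: "face_sum (\<lambda>ys. g ys + h ys) xs = face_sum g xs + face_sum h xs"
  by (simp add: face_sum_def alt_add sum.distrib)

lemma face_sum_diff: "face_sum (\<lambda>ys. g ys - h ys) xs = face_sum g xs - face_sum h xs"
  by (simp add: face_sum_def alt_diff sum_subtractf)

lemma face_sum_zero [simp]: "face_sum (\<lambda>ys. 0) xs = 0"
  by (simp add: face_sum_def)

lemma face_sum_zero_fun [simp]: "face_sum 0 xs = 0"
  by (simp add: face_sum_def)

lemma face_sum_minus: "face_sum (\<lambda>ys. - g ys) xs = - face_sum g xs"
  by (simp add: face_sum_def alt_minus sum_negf)

lemma face_sum_alt: "face_sum (\<lambda>ys. alt k (g ys)) xs = alt k (face_sum g xs)"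
  by (simp add: face_sum_def alt_sum alt_commute)

lemma face_sum_commute:
  "face_sum (\<lambda>s. face_sum (\<lambda>xs. g s xs) xs) s = face_sum (\<lambda>xs. face_sum (\<lambda>s. g s xs) s) xs"
  unfolding face_sum_def alt_sum by (subst sum.swap) (simp add: alt_commute)

lemma face_sum_cong:
  assumes "\<And>i. i < length xs \<Longrightarrow> g (omit i xs) = h (omit i xs)"
  shows "face_sum g xs = face_sum h xs"
  using assms by (simp add: face_sum_def)

lemma face_sum_nonzeroE:
  assumes "face_sum g xs \<noteq> 0"
  obtains i where "i < length xs" "g (omit i xs) \<noteq> 0"
  using sum.not_neutral_contains_not_neutral[OF assms[unfolded face_sum_def]] by auto

text \<open>The recursion \<open>face_sum g (x # xs) = g xs - face_sum (\<lambda>ys. g (x # ys)) xs\<close> exhibits the face sum as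
  an iterated cone, so that the usual cancellation of double faces becomes an induction.\<close>

lemma face_sum_face_sum [simp]: "face_sum (face_sum g) xs = 0"
proof (induction xs arbitrary: g)
  case (Cons x xs)
  show ?case
    unfolding face_sum_Cons face_sum_diff Cons.IH by simp
qed simp

text \<open>The prism operator of the pair of maps \<open>id\<close> and \<open>f\<close> on ordered simplices.\<close>

definition prism :: "('b \<Rightarrow> 'b) \<Rightarrow> ('b list \<Rightarrow> 'g::ab_group_add) \<Rightarrow> 'b list \<Rightarrow> 'g" where
  "prism f g xs = (\<Sum>i<length xs. alt i (g (take (Suc i) xs @ map f (drop i xs))))"

lemma prism_Nil [simp]: "prism f g [] = 0"
  by (simp add: prism_def)

lemma prism_Cons: "prism f g (x # xs) = g (x # f x # map f xs) - prism f (\<lambda>ys. g (x # ys)) xs"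
  unfolding prism_def by (simp add: sum.lessThan_Suc_shift sum_negf del: sum.lessThan_Suc)

lemma prism_diff: "prism f (\<lambda>ys. g ys - h ys) xs = prism f g xs - prism f h xs"
  by (simp add: prism_def alt_diff sum_subtractf)

lemma prism_cong:
  assumes "\<And>i. i < length xs \<Longrightarrow>
    g (take (Suc i) xs @ map f (drop i xs)) = h (take (Suc i) xs @ map f (drop i xs))"
  shows "prism f g xs = prism f h xs"
  using assms by (simp add: prism_def)

lemma prism_nonzeroE:
  assumes "prism f g xs \<noteq> 0"
  obtains i where "i < length xs" "g (take (Suc i) xs @ map f (drop i xs)) \<noteq> 0"
  using sum.not_neutral_contains_not_neutral[OF assms[unfolded prism_def]] by auto

lemma prism_homotopy:
  "face_sum (prism f g) xs + prism f (face_sum g) xs = g (map f xs) - g xs"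
proof (induction xs arbitrary: g)
  case (Cons x xs)
  show ?case
    using Cons[of "\<lambda>ys. g (x # ys)"]
    unfolding face_sum_Cons face_sum_diff prism_Cons prism_diff list.map face_sum_map
    by (simp add: algebra_simps)
qed simp

section \<open>A criterion for quasi-isomorphisms\<close>

lemma additive_subgroup_diff: "additive_subgroup S \<Longrightarrow> a \<in> S \<Longrightarrow> b \<in> S \<Longrightarrow> a - b \<in> S"
  by (simp add: additive_subgroup_def)

lemma additive_subgroup_minus: "additive_subgroup S \<Longrightarrow> a \<in> S \<Longrightarrow> - a \<in> S"
  by (metis additive_subgroup_def diff_0)

lemma additive_subgroup_add: "additive_subgroup S \<Longrightarrow> a \<in> S \<Longrightarrow> b \<in> S \<Longrightarrow> a + b \<in> S"
  by (metis additive_subgroup_diff additive_subgroup_minus diff_minus_eq_add)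

lemma additive_on_diff:
  fixes h :: "'g::ab_group_add \<Rightarrow> 'h::ab_group_add"
  assumes S: "additive_subgroup S" and h: "\<And>a b. a \<in> S \<Longrightarrow> b \<in> S \<Longrightarrow> h (a + b) = h a + h b"
    and "a \<in> S" "b \<in> S"
  shows "h (a - b) = h a - h b"
  using h[OF additive_subgroup_diff[OF S \<open>a \<in> S\<close> \<open>b \<in> S\<close>] \<open>b \<in> S\<close>] by simp

lemma additive_subgroup_coboundaries:
  assumes C: "cochain_complex C"
  shows "additive_subgroup (coboundaries C n)"
proof (cases n)
  case 0
  then show ?thesis
    by (simp add: coboundaries_def additive_subgroup_def)
next
  case (Suc k)
  have S: "additive_subgroup (Coch C k)"
    and add: "\<And>a b. a \<in> Coch C k \<Longrightarrow> b \<in> Coch C k \<Longrightarrow> Diff C k (a + b) = Diff C k a + Diff C k b"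
    using C by (simp_all add: cochain_complex_def)
  have "Diff C k 0 = 0"
    using add[of 0 0] S by (simp add: additive_subgroup_def)
  then show ?thesis
    using S additive_on_diff[OF S add]
    unfolding additive_subgroup_def coboundaries_def Suc nat.case
    by (smt (verit, ccfv_threshold) image_iff)
qed

lemma equiv_cohomologous:
  assumes C: "cochain_complex C"
  shows "equiv (cocycles C n) (cohomologous C n)"
proof (rule equivI)
  note S = additive_subgroup_coboundaries[OF C, of n]
  show "cohomologous C n \<subseteq> cocycles C n \<times> cocycles C n"
    by (auto simp: cohomologous_def)
  show "refl_on (cocycles C n) (cohomologous C n)"
    using S by (auto simp: refl_on_def cohomologous_def additive_subgroup_def)
  show "sym (cohomologous C n)"
    using additive_subgroup_minus[OF S] by (fastforce simp: sym_def cohomologous_def)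
  show "trans (cohomologous C n)"
    using additive_subgroup_add[OF S] by (fastforce simp: trans_def cohomologous_def)
qed

lemma zero_coboundary: "cochain_complex C \<Longrightarrow> 0 \<in> coboundaries C n"
  using additive_subgroup_coboundaries[of C n] by (simp add: additive_subgroup_def)

lemma Diff_diff:
  assumes C: "cochain_complex C" and a: "a \<in> Coch C n" and b: "b \<in> Coch C n"
  shows "Diff C n (a - b) = Diff C n a - Diff C n b"
proof (rule additive_on_diff[OF _ _ a b])
  show "additive_subgroup (Coch C n)"
    using C unfolding cochain_complex_def by blast
  show "Diff C n (a + b) = Diff C n a + Diff C n b" if "a \<in> Coch C n" "b \<in> Coch C n" for a b
    using C that unfolding cochain_complex_def by blast
qed

lemma coboundary_Suc: "e \<in> Coch C n \<Longrightarrow> Diff C n e \<in> coboundaries C (Suc n)"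
  by (simp add: coboundaries_def)

lemma coboundary_in_Coch:
  assumes C: "cochain_complex C" and e: "e \<in> coboundaries C n"
  shows "e \<in> Coch C n" "Diff C n e = 0"
proof -
  have S: "additive_subgroup (Coch C n)" 
    and add: "\<And>a b. a \<in> Coch C n \<Longrightarrow> b \<in> Coch C n \<Longrightarrow> Diff C n (a + b) = Diff C n a + Diff C n b"
    using C by (simp_all add: cochain_complex_def)
  have "Diff C n 0 = 0"
    using add[of 0 0] S by (simp add: additive_subgroup_def)
  then show "e \<in> Coch C n" "Diff C n e = 0"
    using C e S by (auto simp: coboundaries_def cochain_complex_def additive_subgroup_def image_subset_iff split: nat.splits)
qed

lemma cochain_map_coboundary:
  assumes C: "cochain_complex C" and f: "cochain_map f C D" and e: "e \<in> coboundaries C n"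
  shows "f n e \<in> coboundaries D n"
proof (cases n)
  case 0
  have "0 \<in> Coch C 0"
    using C by (simp add: cochain_complex_def additive_subgroup_def)
  then have "f 0 (0 + 0) = f 0 0 + f 0 0"
    using f unfolding cochain_map_def by blast
  then show ?thesis
    using 0 e by (simp add: coboundaries_def)
next
  case (Suc k)
  then show ?thesis
    using e f unfolding cochain_map_def coboundaries_def by force
qed

lemma cochain_map_diff:
  assumes C: "cochain_complex C" and f: "cochain_map f C D" and "a \<in> Coch C n" "b \<in> Coch C n"
  shows "f n (a - b) = f n a - f n b"
  by (rule additive_on_diff[of "Coch C n"]) (use assms in \<open>simp_all add: cochain_complex_def cochain_map_def\<close>)

text \<open>Taking \<open>a = 0\<close> in the lifting condition gives surjectivity on cohomology. Taking \<open>f a\<close> to be the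
  differential of \<open>b\<close> gives injectivity, so one condition covers both.\<close>

lemma quasi_isomorphismI:
  assumes C: "cochain_complex C" and D: "cochain_complex D" and f: "cochain_map f C D"
    and inj: "\<And>n a. a \<in> Coch C n \<Longrightarrow> f n a = 0 \<Longrightarrow> a = 0"
    and lift: "\<And>n b a. b \<in> Coch D n \<Longrightarrow> a \<in> Coch C (Suc n) \<Longrightarrow> Diff D n b = f (Suc n) a \<Longrightarrow>
      \<exists>a'\<in>Coch C n. b - f n a' \<in> coboundaries D n"
  shows "quasi_isomorphism f C D"
proof -
  have subgroup: "additive_subgroup (Coch C n)" for n
    using C by (simp add: cochain_complex_def)
  have D_diff: "Diff D n (a - b) = Diff D n a - Diff D n b" if "a \<in> Coch D n" "b \<in> Coch D n" for n a b
    by (rule Diff_diff[OF D that])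
  have f_Coch: "f n a \<in> Coch D n" if "a \<in> Coch C n" for n a
    using f that by (simp add: cochain_map_def image_subset_iff)
  have Diff_Coch: "Diff C n a \<in> Coch C (Suc n)" if "a \<in> Coch C n" for n a
    using C that by (simp add: cochain_complex_def image_subset_iff)
  have f_Diff: "f (Suc n) (Diff C n a) = Diff D n (f n a)" if "a \<in> Coch C n" for n a
    using f that by (auto simp: cochain_map_def)
  have zero_Coch: "0 \<in> Coch C n" for n
    using subgroup by (simp add: additive_subgroup_def)
  have f_zero: "f n 0 = 0" for n
    using cochain_map_diff[OF C f zero_Coch zero_Coch] by simp
  \<comment> \<open>By injectivity of \<open>f\<close> the relation between \<open>b\<close> and \<open>a\<close> descends to the lift \<open>a'\<close>.\<close>
  have lift_Diff: "\<exists>a'\<in>Coch C n. b - f n a' \<in> coboundaries D n \<and> Diff C n a' = a"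
    if "b \<in> Coch D n" "a \<in> Coch C (Suc n)" "Diff D n b = f (Suc n) a" for n a b
  proof -
    obtain a' where a': "a' \<in> Coch C n" "b - f n a' \<in> coboundaries D n"
      using lift \<open>b \<in> _\<close> \<open>a \<in> _\<close> \<open>Diff D n b = _\<close> by blast
    have "Diff D n b - Diff D n (f n a') = 0"
      using coboundary_in_Coch(2)[OF D a'(2)] D_diff[OF \<open>b \<in> _\<close> f_Coch[OF a'(1)]] by simp
    then have "f (Suc n) (Diff C n a' - a) = 0"
      using cochain_map_diff[OF C f Diff_Coch[OF a'(1)] \<open>a \<in> _\<close>] f_Diff[OF a'(1)] that(3) by simp
    then have "Diff C n a' = a"
      using inj[OF additive_subgroup_diff[OF subgroup Diff_Coch[OF a'(1)] \<open>a \<in> _\<close>]] by simp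
    then show ?thesis
      using a' by blast
  qed
  have f_cocycle: "f n a \<in> cocycles D n" if "a \<in> cocycles C n" for n a
    using that f_Coch f_Diff f_zero unfolding cocycles_def by (metis (mono_tags, lifting) mem_Collect_eq)
  have rel_iff: "(f n a, f n b) \<in> cohomologous D n \<longleftrightarrow> (a, b) \<in> cohomologous C n"
    if a: "a \<in> cocycles C n" and b: "b \<in> cocycles C n" for n a b
  proof -
    have ab: "a \<in> Coch C n" "b \<in> Coch C n"
      using a b by (auto simp: cocycles_def)
    have ab': "a - b \<in> Coch C n"
      using additive_subgroup_diff[OF subgroup] ab by blast
    have "a - b \<in> coboundaries C n" if "f n a - f n b \<in> coboundaries D n"
    proof -
      have fab: "f n (a - b) \<in> coboundaries D n"
        using that cochain_map_diff[OF C f ab] by simp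
      show ?thesis
      proof (cases n)
        case 0
        then show ?thesis
          using fab inj[OF ab'] by (simp add: coboundaries_def)
      next
        case (Suc k)
        then obtain e where e: "e \<in> Coch D k" "Diff D k e = f (Suc k) (a - b)"
          using fab by (auto simp: coboundaries_def)
        then show ?thesis
          using lift_Diff[OF e(1), of "a - b"] ab' Suc coboundary_Suc by metis
      qed
    qed
    then show ?thesis
      using a b f_cocycle cochain_map_coboundary[OF C f, of "a - b" n] cochain_map_diff[OF C f ab]
      by (auto simp: cohomologous_def)
  qed
  have map_class: "cohomology_map f D n (cohomologous C n `` {a}) = cohomologous D n `` {f n a}"
    if a: "a \<in> cocycles C n" for n a
  proof -
    have "(f n a, f n b) \<in> cohomologous D n" if "(a, b) \<in> cohomologous C n" for b
      using that rel_iff[OF a] by (auto simp: cohomologous_def)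
    moreover have "(a, a) \<in> cohomologous C n"
      using equiv_class_self[OF equiv_cohomologous[OF C] a] by simp
    ultimately show ?thesis
      using equiv_cohomologous[OF D, of n] unfolding cohomology_map_def equiv_def
      by (auto dest: transD intro: symD)
  qed
  have "bij_betw (cohomology_map f D n) (cohomology C n) (cohomology D n)" for n
  proof (rule bij_betwI')
    fix c c' assume "c \<in> cohomology C n" "c' \<in> cohomology C n"
    then obtain a a' where a: "a \<in> cocycles C n" "c = cohomologous C n `` {a}"
      and a': "a' \<in> cocycles C n" "c' = cohomologous C n `` {a'}"
      unfolding cohomology_def by (metis quotientE)
    have "cohomologous D n `` {f n a} = cohomologous D n `` {f n a'} \<longleftrightarrow> c = c'"
      using rel_iff a a' f_cocycle
        eq_equiv_class_iff[OF equiv_cohomologous[OF C, of n]] eq_equiv_class_iff[OF equiv_cohomologous[OF D, of n]]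
      by metis
    then show "(cohomology_map f D n c = cohomology_map f D n c') \<longleftrightarrow> c = c'"
      using map_class a a' by simp
  next
    fix c assume "c \<in> cohomology C n"
    then show "cohomology_map f D n c \<in> cohomology D n"
      unfolding cohomology_def by (metis quotientE quotientI map_class f_cocycle)
  next
    fix c assume "c \<in> cohomology D n"
    then obtain b where b: "b \<in> cocycles D n" "c = cohomologous D n `` {b}"
      unfolding cohomology_def by (metis quotientE)
    have "b \<in> Coch D n" "Diff D n b = f (Suc n) 0"
      using b(1) f_zero by (simp_all add: cocycles_def)
    then obtain a where a: "a \<in> Coch C n" "b - f n a \<in> coboundaries D n" "Diff C n a = 0"
      using lift_Diff[OF _ zero_Coch] by blast
    then have a': "a \<in> cocycles C n"
      by (simp add: cocycles_def)
    then have "(b, f n a) \<in> cohomologous D n"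
      using a b f_cocycle by (simp add: cohomologous_def)
    then have "c = cohomology_map f D n (cohomologous C n `` {a})"
      using b map_class[OF a'] equiv_class_eq[OF equiv_cohomologous[OF D]] by simp
    then show "\<exists>x\<in>cohomology C n. c = cohomology_map f D n x"
      using quotientI[OF a', of "cohomologous C n"] unfolding cohomology_def by blast
  qed
  then show ?thesis
    using C D f by (simp add: quasi_isomorphism_def)
qed

context Metric_space
begin

section \<open>Bounded supports\<close>

definition bounded_support :: "('a list \<Rightarrow> 'b::ab_group_add) \<Rightarrow> bool" where
  "bounded_support g \<longleftrightarrow> (\<exists>B. mbounded B \<and> (\<forall>xs. g xs \<noteq> 0 \<longrightarrow> set xs \<subseteq> B))"

lemma bounded_support_zero [simp]: "bounded_support (\<lambda>xs. 0)"
  by (auto simp: bounded_support_def)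

lemma bounded_support_zero_fun [simp]: "bounded_support 0"
  by (auto simp: bounded_support_def)

lemma mbounded_thickening:
  assumes "mbounded B"
  shows "mbounded {x \<in> M. \<exists>y\<in>B. d x y < R}"
proof -
  obtain z C where "B \<subseteq> mcball z C"
    using assms by (auto simp: mbounded_def)
  have "x \<in> mcball z (C + R)" if "x \<in> M" "y \<in> B" "d x y < R" for x y
  proof -
    have "y \<in> mcball z C"
      using \<open>B \<subseteq> _\<close> \<open>y \<in> B\<close> by blast
    then show ?thesis
      using triangle[of z y x] commute[of x y] that by simp
  qed
  then have "{x \<in> M. \<exists>y\<in>B. d x y < R} \<subseteq> mcball z (C + R)"
    by blast
  then show ?thesis
    using mbounded_mcball mbounded_subset by blast
qed

text \<open>The cochains constructed below are sums of finitely many values of given cochains at nearby tuples. A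
  nonzero sum has a nonzero term, so that the support lies in a thickening of the given supports.\<close>

lemma bounded_support_dominated:
  assumes J: "finite J" and g: "\<And>j. j \<in> J \<Longrightarrow> bounded_support (g j)"
    and h: "\<And>xs. h xs \<noteq> 0 \<Longrightarrow>
      set xs \<subseteq> M \<and> (\<exists>j\<in>J. \<exists>ys. g j ys \<noteq> 0 \<and> (\<forall>x\<in>set xs. \<exists>y\<in>set ys. d x y < R))"
  shows "bounded_support h"
proof -
  obtain B where B: "\<And>j. j \<in> J \<Longrightarrow> mbounded (B j)" "\<And>j ys. j \<in> J \<Longrightarrow> g j ys \<noteq> 0 \<Longrightarrow> set ys \<subseteq> B j"
    using g unfolding bounded_support_def by metis
  have "mbounded (\<Union>(B ` J))"
    using J B(1) by (intro mbounded_Union) auto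
  moreover have "set xs \<subseteq> {x \<in> M. \<exists>y\<in>\<Union>(B ` J). d x y < R}" if "h xs \<noteq> 0" for xs
    using h[OF that] B(2) by blast
  ultimately show ?thesis
    using mbounded_thickening[of "\<Union>(B ` J)" R] unfolding bounded_support_def by blast
qed

lemma bounded_support_dominated_same:
  assumes J: "finite J" and g: "\<And>j. j \<in> J \<Longrightarrow> bounded_support (g j)"
    and h: "\<And>xs. h xs \<noteq> 0 \<Longrightarrow> set xs \<subseteq> M \<and> (\<exists>j\<in>J. g j xs \<noteq> 0)"
  shows "bounded_support h"
proof (rule bounded_support_dominated[OF J g, where R = 1])
  fix xs assume "h xs \<noteq> 0"
  then show "set xs \<subseteq> M \<and> (\<exists>j\<in>J. \<exists>ys. g j ys \<noteq> 0 \<and> (\<forall>x\<in>set xs. \<exists>y\<in>set ys. d x y < 1))"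
    using h mdist_zero zero_less_one by (metis subsetD)
qed auto

lemma bounded_support_either:
  assumes "bounded_support g" "bounded_support h" and k: "\<And>xs. k xs \<noteq> 0 \<Longrightarrow> g xs \<noteq> 0 \<or> h xs \<noteq> 0"
  shows "bounded_support k"
proof -
  obtain B C where BC: "mbounded B" "mbounded C"
    "\<And>xs. g xs \<noteq> 0 \<Longrightarrow> set xs \<subseteq> B" "\<And>xs. h xs \<noteq> 0 \<Longrightarrow> set xs \<subseteq> C"
    using assms(1,2) unfolding bounded_support_def by blast
  then have "set xs \<subseteq> B \<union> C" if "k xs \<noteq> 0" for xs
    using k[OF that] by blast
  moreover have "mbounded (B \<union> C)"
    using BC by (simp add: mbounded_Un)
  ultimately show ?thesis
    unfolding bounded_support_def by blast
qed

lemma bounded_support_on_iff: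
  "bounded_support_on T g \<longleftrightarrow> bounded_support (restrict_tuples T g)"
proof -
  have "(\<forall>xs\<in>T. \<not> set xs \<subseteq> B \<longrightarrow> g xs = 0) \<longleftrightarrow> (\<forall>xs. restrict_tuples T g xs \<noteq> 0 \<longrightarrow> set xs \<subseteq> B)" for B
    unfolding restrict_tuples_def by (auto split: if_splits)
  moreover have "(B \<subseteq> M \<and> mbounded B) = mbounded B" for B
    using mbounded_subset_mspace by blast
  ultimately show ?thesis
    unfolding bounded_support_on_def bounded_support_def by (simp flip: conj_assoc)
qed

text \<open>The smallest relation by which the tuple is controlled. It turns the control condition into an
  inclusion between relations, to which monotone operations on entourages apply.\<close>

definition pairs :: "'c list \<Rightarrow> ('c \<times> 'c) set" where
  "pairs xs = set xs \<times> set xs"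

lemma tuplesD: "xs \<in> tuples n \<Longrightarrow> length xs = Suc n" "xs \<in> tuples n \<Longrightarrow> set xs \<subseteq> M"
  by (auto simp: tuples_def)

lemma strip_subset: "strip r \<subseteq> M \<times> M"
  by (auto simp: strip_def)

lemma strip_mono: "r \<le> r' \<Longrightarrow> strip r \<subseteq> strip r'"
  by (auto simp: strip_def)

lemma controlled_tuples_iff:
  "xs \<in> controlled_tuples U n \<longleftrightarrow> xs \<in> tuples n \<and> pairs xs \<subseteq> U"
proof -
  have "(\<forall>i\<le>n. \<forall>j\<le>n. (xs ! i, xs ! j) \<in> U) \<longleftrightarrow> pairs xs \<subseteq> U" if "length xs = Suc n"
  proof -
    have "pairs xs \<subseteq> U \<longleftrightarrow> (\<forall>x\<in>set xs. \<forall>y\<in>set xs. (x, y) \<in> U)"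
      by (auto simp: pairs_def)
    then show ?thesis
      using that by (simp add: all_set_conv_all_nth less_Suc_eq_le)
  qed
  then show ?thesis
    by (auto simp: controlled_tuples_def tuples_def)
qed

lemma pairs_omit_subset: "pairs xs \<subseteq> U \<Longrightarrow> pairs (omit i xs) \<subseteq> U"
  using set_omit_subset[of i xs] by (auto simp: pairs_def)

lemma omit_tuples: "xs \<in> tuples (Suc n) \<Longrightarrow> i < length xs \<Longrightarrow> omit i xs \<in> tuples n"
  using set_omit_subset[of i xs] by (auto simp: tuples_def length_omit)

lemma omit_controlled_tuples:
  "xs \<in> controlled_tuples U (Suc n) \<Longrightarrow> i < length xs \<Longrightarrow> omit i xs \<in> controlled_tuples U n"
  by (simp add: controlled_tuples_iff omit_tuples pairs_omit_subset)

lemma tuple_diff_eq: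
  assumes "T \<subseteq> tuples (Suc n)"
  shows "tuple_diff T n g = (\<lambda>xs. if xs \<in> T then face_sum g xs else 0)"
proof -
  have "{..Suc n} = {..<length xs}" if "xs \<in> T" for xs
    using tuplesD(1)[of xs "Suc n"] that assms by (auto simp: less_Suc_eq_le)
  then show ?thesis
    by (auto simp: tuple_diff_def face_sum_def fun_eq_iff)
qed

text \<open>Omitting an entry of a controlled tuple of length at least two leaves an entry which is
  close to the omitted one; so the differential enlarges supports by a bounded amount.\<close>

lemma bounded_support_face_sum:
  assumes g: "bounded_support g" and g_Nil: "g [] = 0" 
    and h: "\<And>xs. h xs \<noteq> 0 \<Longrightarrow> pairs xs \<subseteq> strip R \<and> face_sum g xs \<noteq> 0"
  shows "bounded_support h"
proof (rule bounded_support_dominated[of "{()}" "\<lambda>_. g"])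
  fix xs assume "h xs \<noteq> 0"
  then have xs: "pairs xs \<subseteq> strip R" and "face_sum g xs \<noteq> 0"
    using h by auto
  then obtain i where i: "g (omit i xs) \<noteq> 0"
    by (auto elim: face_sum_nonzeroE)
  then obtain y where y: "y \<in> set (omit i xs)"
    using g_Nil by (metis list.set_intros(1) list.exhaust)
  then have "d x y < R" if "x \<in> set xs" for x
    using xs that set_omit_subset[of i xs] by (auto simp: pairs_def strip_def)
  then show "set xs \<subseteq> M \<and> (\<exists>j\<in>{()}. \<exists>ys. g ys \<noteq> 0 \<and> (\<forall>x\<in>set xs. \<exists>y\<in>set ys. d x y < R))"
    using i y xs strip_subset[of R] by (auto simp: pairs_def)
qed (use g in auto)

section \<open>Cochains with bounded support on each strip\<close>

text \<open>The strict limit of the complexes of controlled cochains. The strips are cofinal among the entourages,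
  so that it suffices to restrict to them.\<close>

definition limit_coch :: "nat \<Rightarrow> ('a list \<Rightarrow> 'b::ab_group_add) set" where
  "limit_coch n = {\<phi>. (\<forall>xs. xs \<notin> tuples n \<longrightarrow> \<phi> xs = 0) \<and>
      (\<forall>r>0. bounded_support (restrict_tuples (controlled_tuples (strip r) n) \<phi>))}"

lemma limit_coch_Nil: "\<phi> \<in> limit_coch n \<Longrightarrow> \<phi> [] = 0"
  by (auto simp: limit_coch_def tuples_def)

lemma limit_coch_diff:
  assumes "\<phi> \<in> limit_coch n" "\<psi> \<in> limit_coch n"
  shows "\<phi> - \<psi> \<in> limit_coch n"
proof -
  have "bounded_support (restrict_tuples T (\<phi> - \<psi>))"
    if "bounded_support (restrict_tuples T \<phi>)" "bounded_support (restrict_tuples T \<psi>)" for T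
    by (rule bounded_support_either[OF that]) (auto simp: restrict_tuples_def split: if_splits)
  then show ?thesis
    using assms by (simp add: limit_coch_def)
qed

lemma limit_coch_tuple_diff:
  assumes \<phi>: "\<phi> \<in> limit_coch n"
  shows "tuple_diff (tuples (Suc n)) n \<phi> \<in> limit_coch (Suc n)"
proof -
  have "bounded_support (restrict_tuples (controlled_tuples (strip r) (Suc n)) (tuple_diff (tuples (Suc n)) n \<phi>))"
    if "r > 0" for r
  proof (rule bounded_support_face_sum)
    let ?\<psi> = "restrict_tuples (controlled_tuples (strip r) n) \<phi>"
    show "bounded_support ?\<psi>"
      using \<phi> \<open>r > 0\<close> by (simp add: limit_coch_def)
    show "?\<psi> [] = 0"
      using \<phi> by (simp add: restrict_tuples_def limit_coch_Nil)
    fix xs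
    assume nz: "restrict_tuples (controlled_tuples (strip r) (Suc n)) (tuple_diff (tuples (Suc n)) n \<phi>) xs \<noteq> 0"
    then have xs: "xs \<in> controlled_tuples (strip r) (Suc n)" and "face_sum \<phi> xs \<noteq> 0"
      by (auto simp: restrict_tuples_def tuple_diff_eq split: if_splits)
    moreover have "face_sum \<phi> xs = face_sum ?\<psi> xs"
      by (rule face_sum_cong) (simp add: restrict_tuples_def omit_controlled_tuples[OF xs])
    ultimately show "pairs xs \<subseteq> strip r \<and> face_sum ?\<psi> xs \<noteq> 0"
      by (simp add: controlled_tuples_iff)
  qed
  then show ?thesis
    by (simp add: limit_coch_def tuple_diff_eq)
qed

text \<open>If \<open>ys\<close> lies within distance one of an \<open>r\<close>-controlled tuple, then \<open>ys\<close> is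
  \<open>(r + 2)\<close>-controlled. So operations which move points by less than one preserve the strict limit.\<close>

lemma limit_coch_nearby:
  assumes \<phi>: "\<phi> \<in> limit_coch n" and \<psi>: "\<And>xs. xs \<notin> tuples m \<Longrightarrow> \<psi> xs = 0"
    and near: "\<And>xs. \<psi> xs \<noteq> 0 \<Longrightarrow> \<exists>ys. \<phi> ys \<noteq> 0 \<and>
      (\<forall>x\<in>set xs. \<exists>y\<in>set ys. d x y < 1) \<and> (\<forall>y\<in>set ys. \<exists>x\<in>set xs. d x y < 1)"
  shows "\<psi> \<in> limit_coch m"
proof -
  have "bounded_support (restrict_tuples (controlled_tuples (strip r) m) \<psi>)" if "r > 0" for r
  proof (rule bounded_support_dominated[of "{()}" "\<lambda>_. restrict_tuples (controlled_tuples (strip (r + 2)) n) \<phi>" _ 1])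
    show "bounded_support (restrict_tuples (controlled_tuples (strip (r + 2)) n) \<phi>)"
      using \<phi> \<open>r > 0\<close> by (simp add: limit_coch_def)
    fix xs assume "restrict_tuples (controlled_tuples (strip r) m) \<psi> xs \<noteq> 0"
    then have xs: "xs \<in> tuples m" "pairs xs \<subseteq> strip r" "\<psi> xs \<noteq> 0"
      by (auto simp: restrict_tuples_def controlled_tuples_iff split: if_splits)
    then obtain ys where ys: "\<phi> ys \<noteq> 0"
      "\<And>x. x \<in> set xs \<Longrightarrow> \<exists>y\<in>set ys. d x y < 1" "\<And>y. y \<in> set ys \<Longrightarrow> \<exists>x\<in>set xs. d x y < 1"
      using near by meson
    have ys_tuple: "ys \<in> tuples n"
      using ys(1) \<phi> by (auto simp: limit_coch_def)
    have "(y, y') \<in> strip (r + 2)" if "y \<in> set ys" "y' \<in> set ys" for y y'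
    proof -
      obtain x x' where x: "x \<in> set xs" "d x y < 1" and x': "x' \<in> set xs" "d x' y' < 1"
        using ys(3) \<open>y \<in> _\<close> \<open>y' \<in> _\<close> by blast
      have in_M: "x \<in> M" "x' \<in> M" "y \<in> M" "y' \<in> M"
        using x x' that xs(1) ys_tuple by (auto simp: tuples_def)
      have "d x x' < r"
        using x x' xs(2) by (auto simp: pairs_def strip_def)
      moreover have "d y y' \<le> d x y + d x x' + d x' y'"
        using triangle[of y x y'] triangle[of x x' y'] commute[of x y] in_M by simp
      ultimately show ?thesis
        using in_M x x' by (simp add: strip_def)
    qed
    then have "ys \<in> controlled_tuples (strip (r + 2)) n"
      using ys_tuple by (auto simp: controlled_tuples_iff pairs_def)
    then show "set xs \<subseteq> M \<and> (\<exists>j\<in>{()}. \<exists>ys. restrict_tuples (controlled_tuples (strip (r + 2)) n) \<phi> ys \<noteq> 0 \<and>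
        (\<forall>x\<in>set xs. \<exists>y\<in>set ys. d x y < 1))"
      using ys(1,2) tuplesD(2)[OF xs(1)] by (auto simp: restrict_tuples_def)
  qed auto
  then show ?thesis
    using \<psi> by (simp add: limit_coch_def)
qed

section \<open>Locally bounded Borel cochains\<close>

lemma topspace_tuple_topology [simp]: "topspace (tuple_topology n) = tuples n"
proof -
  have "(\<lambda>i\<in>{..n}. xs ! i) \<in> {..n} \<rightarrow>\<^sub>E M" if "xs \<in> tuples n" for xs
    using that by (auto simp: tuples_def subset_iff)
  then show ?thesis
    by (auto simp: tuple_topology_def topspace_pullback_topology)
qed

lemma continuous_map_entry:
  assumes "j \<le> n"
  shows "continuous_map (tuple_topology n) mtopology (\<lambda>xs. xs ! j)"
proof -
  have "continuous_map (product_topology (\<lambda>_. mtopology) {..n}) mtopology (\<lambda>u. u j)"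
    using assms by (intro continuous_map_product_projection) simp
  from continuous_map_pullback[OF this, of "tuples n" "\<lambda>xs. \<lambda>i\<in>{..n}. xs ! i"] assms show ?thesis
    by (simp add: tuple_topology_def o_def)
qed

lemma continuous_map_into_tuples:
  assumes "\<And>x. x \<in> topspace T \<Longrightarrow> h x \<in> tuples n"
    and "\<And>j. j \<le> n \<Longrightarrow> continuous_map T mtopology (\<lambda>x. h x ! j)"
  shows "continuous_map T (tuple_topology n) h"
  unfolding tuple_topology_def
proof (rule continuous_map_pullback')
  show "continuous_map T (product_topology (\<lambda>_. mtopology) {..n}) ((\<lambda>xs. \<lambda>i\<in>{..n}. xs ! i) \<circ> h)"
    using assms(2) by (auto simp: continuous_map_componentwise o_def)
  show "topspace T \<subseteq> h -` tuples n"
    using assms(1) by auto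
qed

lemma space_tuple_borel [simp]: "space (tuple_borel n) = tuples n"
  using openin_subset[of "tuple_topology n"]
  by (auto simp: tuple_borel_def intro!: space_measure_of)

definition point_borel :: "'a measure" where
  "point_borel = sigma M {W. openin mtopology W}"

lemma space_point_borel [simp]: "space point_borel = M"
  using openin_subset[of mtopology] by (auto simp: point_borel_def intro!: space_measure_of)

lemma sets_point_borel_open: "openin mtopology W \<Longrightarrow> W \<in> sets point_borel"
  using openin_subset[of mtopology] by (auto simp: point_borel_def intro!: in_measure_of)

lemma measurable_continuous_map:
  assumes h: "continuous_map (tuple_topology n) T h"
  shows "h \<in> measurable (tuple_borel n) (sigma (topspace T) {W. openin T W})"
proof (rule measurable_measure_of)
  show "{W. openin T W} \<subseteq> Pow (topspace T)"
    using openin_subset by auto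
  show "h \<in> space (tuple_borel n) \<rightarrow> topspace T"
    using continuous_map_funspace[OF h] by simp
  fix W assume "W \<in> {W. openin T W}"
  then have "openin (tuple_topology n) {x \<in> topspace (tuple_topology n). h x \<in> W}"
    using openin_continuous_map_preimage[OF h] by blast
  moreover have "h -` W \<inter> space (tuple_borel n) = {x \<in> topspace (tuple_topology n). h x \<in> W}"
    by auto
  moreover have "{W. openin (tuple_topology n) W} \<subseteq> Pow (tuples n)"
    using openin_subset[of "tuple_topology n"] by auto
  ultimately show "h -` W \<inter> space (tuple_borel n) \<in> sets (tuple_borel n)"
    by (simp add: tuple_borel_def in_measure_of)
qed

lemma measurable_entry: "j \<le> n \<Longrightarrow> (\<lambda>xs. xs ! j) \<in> measurable (tuple_borel n) point_borel"
  using measurable_continuous_map[OF continuous_map_entry] by (simp add: point_borel_def)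

lemma measurable_continuous_tuples:
  assumes "\<And>xs. xs \<in> tuples n \<Longrightarrow> h xs \<in> tuples m"
    and "\<And>j. j \<le> m \<Longrightarrow> continuous_map (tuple_topology n) mtopology (\<lambda>xs. h xs ! j)"
  shows "h \<in> measurable (tuple_borel n) (tuple_borel m)"
  using measurable_continuous_map[OF continuous_map_into_tuples, of n h m] assms
  by (simp add: tuple_borel_def)

text \<open>The closure of a bounded set is compact, and its powers are compact by Tychonoff's theorem.\<close>

lemma compactin_bounded_tuples:
  assumes proper_metric and B: "mbounded B"
  obtains K where "compactin (tuple_topology n) K" "{xs \<in> tuples n. set xs \<subseteq> B} \<subseteq> K"
proof -
  let ?C = "mtopology closure_of B"
  let ?P = "product_topology (\<lambda>_. mtopology) {..n}"
  let ?h = "\<lambda>u. map u [0..<Suc n]"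
  have C: "compactin mtopology ?C"
    using assms mbounded_closure_of by (simp add: proper_metric_def)
  have "continuous_map ?P mtopology (\<lambda>u. ?h u ! j)" if "j \<le> n" for j
  proof -
    have "continuous_map ?P mtopology (\<lambda>u. u j)"
      using that by (intro continuous_map_product_projection) simp
    moreover have "?h u ! j = u j" for u :: "nat \<Rightarrow> 'a"
      using that by (simp del: upt_Suc)
    ultimately show ?thesis
      by (simp del: upt_Suc)
  qed
  then have "continuous_map ?P (tuple_topology n) ?h"
    by (intro continuous_map_into_tuples) (auto simp: tuples_def PiE_iff)
  moreover have "compactin ?P ({..n} \<rightarrow>\<^sub>E ?C)"
    using C by (simp add: compactin_PiE)
  ultimately have "compactin (tuple_topology n) (?h ` ({..n} \<rightarrow>\<^sub>E ?C))"
    by (metis image_compactin)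
  moreover have "xs \<in> ?h ` ({..n} \<rightarrow>\<^sub>E ?C)" if "xs \<in> tuples n" "set xs \<subseteq> B" for xs
  proof (rule image_eqI)
    show "xs = ?h (\<lambda>i\<in>{..n}. xs ! i)"
      using tuplesD(1)[OF that(1)] by (auto intro!: nth_equalityI simp del: upt_Suc)
    have "B \<subseteq> ?C"
      using mbounded_subset_mspace[OF B] by (simp add: closure_of_subset)
    then show "(\<lambda>i\<in>{..n}. xs ! i) \<in> {..n} \<rightarrow>\<^sub>E ?C"
      using that tuplesD(1)[OF that(1)] by (auto simp: subset_iff)
  qed
  ultimately show thesis
    using that by blast
qed

text \<open>Compactness of bounded sets makes local boundedness a condition on bounded sets. Conversely every tuple
  has a bounded neighbourhood.\<close>

lemma locally_bounded_iff:
  assumes proper_metric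
  shows "locally_bounded n \<phi> \<longleftrightarrow> (\<forall>B. mbounded B \<longrightarrow> finite (\<phi> ` {xs \<in> tuples n. set xs \<subseteq> B}))"
proof (intro iffI allI impI)
  fix B assume lb: "locally_bounded n \<phi>" and "mbounded B"
  then obtain K where K: "compactin (tuple_topology n) K" "{xs \<in> tuples n. set xs \<subseteq> B} \<subseteq> K"
    using compactin_bounded_tuples assms by metis
  let ?W = "{W. openin (tuple_topology n) W \<and> finite (\<phi> ` W)}"
  have "K \<subseteq> \<Union>?W"
  proof
    fix xs assume "xs \<in> K"
    then have "xs \<in> tuples n"
      using compactin_subset_topspace[OF K(1)] by auto
    then obtain W where "openin (tuple_topology n) W" "xs \<in> W" "finite (\<phi> ` W)"
      using lb unfolding locally_bounded_def by blast
    then show "xs \<in> \<Union>?W"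
      by blast
  qed
  then have "\<exists>F. finite F \<and> F \<subseteq> ?W \<and> K \<subseteq> \<Union>F"
    by (intro compactinD[OF K(1)]) auto
  then obtain F where F: "finite F" "F \<subseteq> ?W" "K \<subseteq> \<Union>F"
    by blast
  then have "finite (\<Union>W\<in>F. \<phi> ` W)"
    by auto
  moreover have "\<phi> ` {xs \<in> tuples n. set xs \<subseteq> B} \<subseteq> (\<Union>W\<in>F. \<phi> ` W)"
    using image_mono[OF order_trans[OF K(2) F(3)], of \<phi>] by (simp add: image_Union)
  ultimately show "finite (\<phi> ` {xs \<in> tuples n. set xs \<subseteq> B})"
    using finite_subset by blast
next
  assume fin: "\<forall>B. mbounded B \<longrightarrow> finite (\<phi> ` {xs \<in> tuples n. set xs \<subseteq> B})"
  show "locally_bounded n \<phi>"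
    unfolding locally_bounded_def
  proof
    fix xs assume xs: "xs \<in> tuples n"
    let ?W = "(\<Inter>i\<in>{..n}. {ys \<in> topspace (tuple_topology n). ys ! i \<in> mball (xs ! i) 1}) \<inter>
      topspace (tuple_topology n)"
    let ?B = "\<Union>((\<lambda>i. mball (xs ! i) 1) ` {..n})"
    have "openin (tuple_topology n) ?W"
      by (intro openin_INT openin_continuous_map_preimage[OF continuous_map_entry]) auto
    moreover have "xs \<in> ?W"
      using xs by (auto simp: tuples_def subset_iff)
    moreover have "mbounded ?B"
      by (intro mbounded_Union) auto
    then have "finite (\<phi> ` {ys \<in> tuples n. set ys \<subseteq> ?B})"
      using fin by blast
    then have "finite (\<phi> ` ?W)"
    proof (rule rev_finite_subset, intro image_mono)
      show "?W \<subseteq> {ys \<in> tuples n. set ys \<subseteq> ?B}"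
      proof
        fix ys assume ys: "ys \<in> ?W"
        have "y \<in> ?B" if y: "y \<in> set ys" for y
        proof -
          obtain i where "i < length ys" "y = ys ! i"
            using y by (auto simp: in_set_conv_nth)
          then have "i \<in> {..n}" "y \<in> mball (xs ! i) 1"
            using ys tuplesD(1)[of ys n] by auto
          then show ?thesis
            by blast
        qed
        then show "ys \<in> {ys \<in> tuples n. set ys \<subseteq> ?B}"
          using ys by auto
      qed
    qed
    ultimately show "\<exists>W. openin (tuple_topology n) W \<and> xs \<in> W \<and> finite (\<phi> ` W)"
      by blast
  qed
qed

text \<open>Locally bounded Borel functions, with local boundedness in the form of \<open>locally_bounded_iff\<close>: this
  form is inherited under composition with any map which preserves bounded sets, continuous or not.\<close>

definition regular :: "nat \<Rightarrow> ('a list \<Rightarrow> 'b) \<Rightarrow> bool" where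
  "regular n \<phi> \<longleftrightarrow> \<phi> \<in> measurable (tuple_borel n) (count_space UNIV) \<and>
     (\<forall>B. mbounded B \<longrightarrow> finite (\<phi> ` {xs \<in> tuples n. set xs \<subseteq> B}))"

lemma regular_cong:
  assumes "\<And>xs. xs \<in> tuples n \<Longrightarrow> \<phi> xs = \<psi> xs"
  shows "regular n \<phi> \<longleftrightarrow> regular n \<psi>"
proof -
  have "\<phi> ` {xs \<in> tuples n. set xs \<subseteq> B} = \<psi> ` {xs \<in> tuples n. set xs \<subseteq> B}" for B
    using assms by (intro image_cong) auto
  then show ?thesis
    using assms measurable_cong[of "tuple_borel n" \<phi> \<psi>] by (simp add: regular_def)
qed

lemma regular_const [simp]: "regular n (\<lambda>xs. c)"
proof -
  have "finite ((\<lambda>xs. c) ` {xs \<in> tuples n. set xs \<subseteq> B})" for B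
    by (rule finite_subset[of _ "{c}"]) auto
  then show ?thesis
    by (simp add: regular_def)
qed

text \<open>The space is a countable union of bounded sets. Countability of the range is what makes the sum of two
  locally bounded Borel functions Borel, even if the group is uncountable.\<close>

lemma countable_image_of_finite_on_bounded:
  assumes "\<And>B. mbounded B \<Longrightarrow> finite (\<phi> ` {xs \<in> tuples n. set xs \<subseteq> B})"
  shows "countable (\<phi> ` tuples n)"
proof (cases "M = {}")
  case True
  have "xs \<notin> tuples n" for xs
    using True tuplesD[of xs n] by (cases xs) auto
  then have "tuples n = {}"
    by blast
  then show ?thesis
    by simp
next
  case False
  then obtain z where z: "z \<in> M"
    by auto
  have "\<exists>k::nat. set xs \<subseteq> mcball z (real k)" if "xs \<in> tuples n" for xs
  proof -
    have "\<exists>k::nat. \<forall>x\<in>set xs. d z x \<le> real k"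
    proof -
      have "bdd_above (d z ` set xs)"
        by simp
      then obtain b where "\<And>x. x \<in> set xs \<Longrightarrow> d z x \<le> b"
        by (auto simp: bdd_above_def)
      then show ?thesis
        using real_arch_simple[of b] order_trans by blast
    qed
    then show ?thesis
      using z that by (auto simp: tuples_def subset_iff)
  qed
  then have "\<phi> ` tuples n \<subseteq> (\<Union>k::nat. \<phi> ` {xs \<in> tuples n. set xs \<subseteq> mcball z (real k)})"
    by blast
  moreover have "countable (\<Union>k::nat. \<phi> ` {xs \<in> tuples n. set xs \<subseteq> mcball z (real k)})"
    by (intro countable_UN[OF countableI_type] countable_finite assms mbounded_mcball)
  ultimately show ?thesis
    using countable_subset by blast
qed

lemma regular_binop:
  assumes \<phi>: "regular n \<phi>" and \<psi>: "regular n \<psi>"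
  shows "regular n (\<lambda>xs. F (\<phi> xs) (\<psi> xs))"
  unfolding regular_def
proof (intro conjI allI impI)
  have \<phi>': "\<phi> \<in> measurable (tuple_borel n) (count_space (\<phi> ` tuples n))"
    using \<phi> measurable_count_space_extend[of "\<phi> ` tuples n" UNIV \<phi> "tuple_borel n"]
    by (auto simp: regular_def)
  show "(\<lambda>xs. F (\<phi> xs) (\<psi> xs)) \<in> measurable (tuple_borel n) (count_space UNIV)"
  proof (rule measurable_compose_countable'[where f = "\<lambda>a xs. F a (\<psi> xs)" and g = \<phi>, OF _ \<phi>'])
    show "(\<lambda>xs. F a (\<psi> xs)) \<in> measurable (tuple_borel n) (count_space UNIV)" for a
      using \<psi> unfolding regular_def by (auto intro: measurable_compose)
    show "countable (\<phi> ` tuples n)"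
      using \<phi> by (intro countable_image_of_finite_on_bounded) (simp add: regular_def)
  qed
  fix B assume "mbounded B"
  then have "finite ((\<lambda>(a, b). F a b) ` (\<phi> ` {xs \<in> tuples n. set xs \<subseteq> B} \<times> \<psi> ` {xs \<in> tuples n. set xs \<subseteq> B}))"
    using \<phi> \<psi> by (auto simp: regular_def)
  then show "finite ((\<lambda>xs. F (\<phi> xs) (\<psi> xs)) ` {xs \<in> tuples n. set xs \<subseteq> B})"
    by (rule finite_subset[rotated]) auto
qed

lemma regular_alt:
  "regular n \<phi> \<Longrightarrow> regular n (\<lambda>xs. alt k (\<phi> xs))"
  using regular_binop[of n \<phi> "\<lambda>_. undefined" "\<lambda>a b. alt k a"] by simp

lemma regular_sum:
  assumes "finite I" "\<And>i. i \<in> I \<Longrightarrow> regular n (\<phi> i)"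
  shows "regular n (\<lambda>xs. \<Sum>i\<in>I. \<phi> i xs)"
  using assms
proof (induction rule: finite_induct)
  case (insert i I)
  then show ?case
    using regular_binop[of n "\<phi> i" "\<lambda>xs. \<Sum>i\<in>I. \<phi> i xs" "(+)"] by simp
qed simp

lemma regular_compose:
  assumes \<phi>: "regular m \<phi>" and T: "T \<in> measurable (tuple_borel n) (tuple_borel m)"
    and bounded: "\<And>B. mbounded B \<Longrightarrow>
      \<exists>B'. mbounded B' \<and> (\<forall>xs\<in>tuples n. set xs \<subseteq> B \<longrightarrow> set (T xs) \<subseteq> B')"
  shows "regular n (\<lambda>xs. \<phi> (T xs))"
  unfolding regular_def
proof (intro conjI allI impI)
  show "(\<lambda>xs. \<phi> (T xs)) \<in> measurable (tuple_borel n) (count_space UNIV)"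
    using T \<phi> unfolding regular_def by (blast intro: measurable_compose)
  fix B assume B: "mbounded B"
  obtain B' where B': "mbounded B'" "\<And>xs. xs \<in> tuples n \<Longrightarrow> set xs \<subseteq> B \<Longrightarrow> set (T xs) \<subseteq> B'"
    using bounded[OF B] by metis
  have "finite (\<phi> ` {ys \<in> tuples m. set ys \<subseteq> B'})"
    using \<phi> B' by (simp add: regular_def)
  moreover have "T xs \<in> tuples m" if "xs \<in> tuples n" for xs
    using measurable_space[OF T] that by simp
  then have "(\<lambda>xs. \<phi> (T xs)) ` {xs \<in> tuples n. set xs \<subseteq> B} \<subseteq> \<phi> ` {ys \<in> tuples m. set ys \<subseteq> B'}"
    using B'(2) by blast
  ultimately show "finite ((\<lambda>xs. \<phi> (T xs)) ` {xs \<in> tuples n. set xs \<subseteq> B})"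
    using finite_subset by blast
qed

lemma regular_omit:
  assumes "regular n \<phi>" "i \<le> Suc n"
  shows "regular (Suc n) (\<lambda>xs. \<phi> (omit i xs))"
proof (rule regular_compose[OF assms(1)])
  show "omit i \<in> measurable (tuple_borel (Suc n)) (tuple_borel n)"
  proof (rule measurable_continuous_tuples)
    fix xs assume "xs \<in> tuples (Suc n)"
    then show "omit i xs \<in> tuples n"
      using assms(2) by (simp add: omit_tuples tuplesD)
  next
    fix j assume j: "j \<le> n"
    have "omit i xs ! j = xs ! (if j < i then j else Suc j)" if "xs \<in> topspace (tuple_topology (Suc n))" for xs
      using that j assms(2) tuplesD(1)[of xs "Suc n"] by (auto simp: omit_def nth_append min_def)
    moreover have "continuous_map (tuple_topology (Suc n)) mtopology (\<lambda>xs. xs ! (if j < i then j else Suc j))"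
      using j by (intro continuous_map_entry) auto
    ultimately show "continuous_map (tuple_topology (Suc n)) mtopology (\<lambda>xs. omit i xs ! j)"
      by (metis (no_types, lifting) continuous_map_eq)
  qed
  show "\<exists>B'. mbounded B' \<and> (\<forall>xs\<in>tuples (Suc n). set xs \<subseteq> B \<longrightarrow> set (omit i xs) \<subseteq> B')" if "mbounded B" for B
    using that set_omit_subset by (metis order_trans)
qed

lemma regular_tuple_diff:
  assumes "regular n \<phi>"
  shows "regular (Suc n) (tuple_diff (tuples (Suc n)) n \<phi>)"
proof -
  have "regular (Suc n) (\<lambda>xs. \<Sum>i\<le>Suc n. alt i (\<phi> (omit i xs)))"
    using assms by (intro regular_sum regular_alt regular_omit) auto
  then show ?thesis
    by (rule iffD1[OF regular_cong, rotated]) (simp add: tuple_diff_def)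
qed

section \<open>Discretization of a proper metric space\<close>

definition discretization :: "('a \<Rightarrow> 'a) \<Rightarrow> bool" where
  "discretization f \<longleftrightarrow> f \<in> measurable point_borel (count_space M) \<and>
     (\<forall>x\<in>M. d x (f x) < 1) \<and> (\<forall>B. mbounded B \<longrightarrow> finite (f ` B))"

lemma discretizationD:
  assumes "discretization f"
  shows "x \<in> M \<Longrightarrow> f x \<in> M" "x \<in> M \<Longrightarrow> d x (f x) < 1" "mbounded B \<Longrightarrow> finite (f ` B)"
    "f \<in> measurable point_borel (count_space M)"
  using assms measurable_space[of f point_borel "count_space M" x] by (auto simp: discretization_def)

text \<open>The balls of integral radius around a point are totally bounded. This gives a countable set of centres
  such that each bounded set is covered by finitely many of the unit balls around them. Points are sent
  to the first centre at distance less than one. The fibres are differences of finite unions of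
  balls, hence Borel.\<close>

lemma ex_discretization:
  assumes proper_metric
  shows "\<exists>f. discretization f"
proof (cases "M = {}")
  case True
  show ?thesis
    unfolding discretization_def
  proof (intro exI[of _ id] conjI allI impI ballI)
    show "id \<in> measurable point_borel (count_space M)"
      using True by (intro iffD2[OF measurable_empty_iff]) (metis space_count_space, metis space_point_borel)
    show "d x (id x) < 1" if "x \<in> M" for x
      using that by simp
    show "finite (id ` B)" if "mbounded B" for B
      using mbounded_subset_mspace[OF that] True by simp
  qed
next
  case False
  then obtain z where z: "z \<in> M"
    by auto
  have "compactin mtopology (mcball z (real k))" for k :: nat
    using assms by (simp add: proper_metric_def mbounded_mcball)
  then have "\<exists>K. finite K \<and> K \<subseteq> mcball z (real k) \<and> mcball z (real k) \<subseteq> (\<Union>y\<in>K. mball y 1)" for k :: nat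
    using compactin_imp_mtotally_bounded unfolding mtotally_bounded_def by (metis zero_less_one)
  then obtain K where K: "\<And>k. finite (K k)" "\<And>k. K k \<subseteq> mcball z (real k)"
    "\<And>k. mcball z (real k) \<subseteq> (\<Union>y\<in>K k. mball y 1)"
    by metis
  define Y where "Y = (\<Union>k. K k)"
  have "countable Y"
    unfolding Y_def by (intro countable_UN[OF countableI_type] countable_finite K(1))
  have "z \<in> mcball z (real 0)"
    using z by simp
  then have "K 0 \<noteq> {}"
    using K(3)[of 0] by blast
  then have "Y \<noteq> {}"
    unfolding Y_def by blast
  define y where "y = from_nat_into Y"
  have range_y: "range y = Y"
    unfolding y_def by (rule range_from_nat_into[OF \<open>Y \<noteq> {}\<close> \<open>countable Y\<close>])
  have y_in: "y i \<in> M" for i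
  proof -
    have "y i \<in> Y"
      using range_y by blast
    then obtain k where "y i \<in> K k"
      unfolding Y_def by blast
    then show ?thesis
      using K(2)[of k] by auto
  qed
  define ind where "ind x = (LEAST i. d x (y i) < 1)" for x
  have cover: "\<exists>N. \<forall>x\<in>mcball z (real k). ind x \<le> N \<and> d x (y (ind x)) < 1" for k
  proof -
    have "\<forall>c\<in>K k. \<exists>i. c = y i"
      using range_y by (auto simp: Y_def)
    then obtain j where j: "\<And>c. c \<in> K k \<Longrightarrow> c = y (j c)"
      by metis
    have "ind x \<le> Max (j ` K k) \<and> d x (y (ind x)) < 1" if x: "x \<in> mcball z (real k)" for x
    proof -
      obtain c where c: "c \<in> K k" "x \<in> mball c 1"
        using K(3)[of k] x by blast
      then have near: "d x (y (j c)) < 1"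
        using j[OF c(1)] by (simp add: commute)
      then have "ind x \<le> j c"
        unfolding ind_def by (rule Least_le)
      also have "\<dots> \<le> Max (j ` K k)"
        using c K(1) by simp
      finally show ?thesis
        using LeastI[of "\<lambda>i. d x (y i) < 1", OF near] by (simp add: ind_def)
    qed
    then show ?thesis
      by blast
  qed
  have ind_near: "d x (y (ind x)) < 1" if "x \<in> M" for x
  proof -
    obtain k :: nat where "d z x \<le> real k"
      using real_arch_simple by metis
    then show ?thesis
      using cover[of k] that z by auto
  qed
  have "ind \<in> measurable point_borel (count_space UNIV)"
  proof (rule measurableI)
    fix S
    have fiber: "{x \<in> M. ind x = i} = mball (y i) 1 - (\<Union>j\<in>{..<i}. mball (y j) 1)" for i
    proof (intro equalityI subsetI)
      fix x assume "x \<in> {x \<in> M. ind x = i}"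
      then have x: "x \<in> M" "ind x = i"
        by auto
      have "x \<in> mball (y i) 1"
        using ind_near[OF x(1)] x y_in[of i] commute[of x "y i"] by simp
      moreover have "x \<notin> mball (y j) 1" if "j < i" for j
        using not_less_Least[of j "\<lambda>i. d x (y i) < 1"] that x(2) commute[of x "y j"]
        by (simp add: ind_def)
      ultimately show "x \<in> mball (y i) 1 - (\<Union>j\<in>{..<i}. mball (y j) 1)"
        by blast
    next
      fix x assume x: "x \<in> mball (y i) 1 - (\<Union>j\<in>{..<i}. mball (y j) 1)"
      have "ind x = i"
        unfolding ind_def
      proof (rule Least_equality)
        show "d x (y i) < 1"
          using x commute[of x "y i"] by simp
        show "i \<le> j" if "d x (y j) < 1" for j
        proof (rule ccontr)
          assume "\<not> i \<le> j"
          then have "x \<notin> mball (y j) 1"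
            using x by auto
          then show False
            using x that y_in[of j] commute[of x "y j"] by simp
        qed
      qed
      then show "x \<in> {x \<in> M. ind x = i}"
        using x by simp
    qed
    have "{x \<in> M. ind x = i} \<in> sets point_borel" for i
      unfolding fiber using openin_mball by (intro sets.Diff sets.finite_UN sets_point_borel_open) auto
    then have "(\<Union>i\<in>S. {x \<in> M. ind x = i}) \<in> sets point_borel"
      by (intro sets.countable_UN') auto
    moreover have "ind -` S \<inter> space point_borel = (\<Union>i\<in>S. {x \<in> M. ind x = i})"
      by auto
    ultimately show "ind -` S \<inter> space point_borel \<in> sets point_borel"
      by simp
  qed simp
  moreover have "y \<in> measurable (count_space UNIV) (count_space M)"
    using y_in by simp
  ultimately have "(\<lambda>x. y (ind x)) \<in> measurable point_borel (count_space M)"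
    by (rule measurable_compose)
  moreover have "finite ((\<lambda>x. y (ind x)) ` B)" if B: "mbounded B" for B
  proof -
    obtain b where b: "\<And>x. x \<in> B \<Longrightarrow> d z x \<le> b"
      using B z mbounded_insert[of z B] mbounded_alt[of "insert z B"] by auto
    obtain k :: nat where "b \<le> real k"
      using real_arch_simple by blast
    then have "B \<subseteq> mcball z (real k)"
      using b z mbounded_subset_mspace[OF B] by force
    then obtain N where "\<And>x. x \<in> B \<Longrightarrow> ind x \<le> N"
      using cover[of k] by blast
    then have "(\<lambda>x. y (ind x)) ` B \<subseteq> y ` {..N}"
      by auto
    then show ?thesis
      using finite_subset by blast
  qed
  ultimately have "discretization (\<lambda>x. y (ind x))"
    using ind_near by (simp add: discretization_def)
  then show ?thesis
    by blast
qed

lemma finite_imp_mbounded: "finite S \<Longrightarrow> S \<subseteq> M \<Longrightarrow> mbounded S"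
  by (induction rule: finite_induct) (simp_all add: mbounded_insert)

context
  fixes f
  assumes f: "discretization f"
begin

lemma countable_discretization_image: "countable (f ` M)"
proof -
  have "(\<lambda>xs. f (hd xs)) ` tuples 0 = f ` M"
    by (force simp: tuples_def length_Suc_conv image_iff)
  moreover have "countable ((\<lambda>xs. f (hd xs)) ` tuples 0)"
  proof (rule countable_image_of_finite_on_bounded)
    fix B assume B: "mbounded B"
    have "(\<lambda>xs. f (hd xs)) ` {xs \<in> tuples 0. set xs \<subseteq> B} \<subseteq> f ` B"
      by (auto simp: tuples_def length_Suc_conv)
    then show "finite ((\<lambda>xs. f (hd xs)) ` {xs \<in> tuples 0. set xs \<subseteq> B})"
      using finite_subset discretizationD(3)[OF f B] by blast
  qed
  ultimately show ?thesis
    by simp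
qed

text \<open>The discretized entries take countably many values, so measurability can be checked with the values
  held fixed, one entry at a time.\<close>

lemma measurable_map_discretization:
  assumes "\<And>j. j \<in> set js \<Longrightarrow> j \<le> n"
  shows "(\<lambda>xs. map (\<lambda>j. f (xs ! j)) js) \<in>
    measurable (tuple_borel n) (count_space {ys. set ys \<subseteq> f ` M \<and> length ys = length js})"
  using assms
proof (induction js)
  case Nil
  then show ?case
    by simp
next
  case (Cons j js)
  let ?L = "\<lambda>k. {ys. set ys \<subseteq> f ` M \<and> length ys = k}"
  have entry: "(\<lambda>xs. xs ! j) \<in> measurable (tuple_borel n) point_borel"
    using Cons.prems by (intro measurable_entry) simp
  have "(\<lambda>xs. f (xs ! j)) \<in> measurable (tuple_borel n) (count_space M)"
    using measurable_compose[OF entry discretizationD(4)[OF f]] .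
  then have head: "(\<lambda>xs. f (xs ! j)) \<in> measurable (tuple_borel n) (count_space (f ` M))"
    by (rule measurable_count_space_extend[rotated 2])
      (use discretizationD(1)[OF f] measurable_space[OF entry] in auto)
  have tail: "(\<lambda>xs. map (\<lambda>j. f (xs ! j)) js) \<in> measurable (tuple_borel n) (count_space (?L (length js)))"
    using Cons by simp
  show ?case
    unfolding list.map
  proof (rule measurable_compose_countable'[where f = "\<lambda>y xs. y # map (\<lambda>j. f (xs ! j)) js",
        OF _ head countable_discretization_image])
    fix y assume "y \<in> f ` M"
    then have "(#) y \<in> measurable (count_space (?L (length js))) (count_space (?L (length (j # js))))"
      by auto
    then show "(\<lambda>xs. y # map (\<lambda>j. f (xs ! j)) js) \<in>
        measurable (tuple_borel n) (count_space (?L (length (j # js))))"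
      using tail by (rule measurable_compose[rotated])
  qed
qed

lemma countable_lists_discretization: "countable {ys. set ys \<subseteq> f ` M \<and> length ys = k}"
  using countable_lists[OF countable_discretization_image]
  by (rule countable_subset[rotated]) (auto simp: lists_eq_set)

lemma set_map_discretization_subset: "set xs \<subseteq> B \<Longrightarrow> set (map f xs) \<subseteq> f ` B"
  by auto

text \<open>A function of the discretized tuple is a function on a countable discrete set, and for tuples
  in a bounded set on a finite one.\<close>

lemma regular_map_discretization: "regular n (\<lambda>xs. \<phi> (map f xs))"
  unfolding regular_def
proof (intro conjI allI impI)
  have "(\<lambda>xs. \<phi> (map (\<lambda>j. f (xs ! j)) [0..<Suc n])) \<in> measurable (tuple_borel n) (count_space UNIV)"
    by (rule measurable_compose[OF measurable_map_discretization]) auto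
  moreover have "map (\<lambda>j. f (xs ! j)) [0..<Suc n] = map f xs" if "xs \<in> tuples n" for xs
    using tuplesD(1)[OF that] by (intro nth_equalityI) (auto simp del: upt_Suc)
  ultimately show "(\<lambda>xs. \<phi> (map f xs)) \<in> measurable (tuple_borel n) (count_space UNIV)"
    using measurable_cong[of "tuple_borel n" "\<lambda>xs. \<phi> (map f xs)" "\<lambda>xs. \<phi> (map (\<lambda>j. f (xs ! j)) [0..<Suc n])"]
    by (simp del: upt_Suc)
  fix B assume "mbounded B"
  then have "finite {ys. set ys \<subseteq> f ` B \<and> length ys = Suc n}"
    using discretizationD(3)[OF f] finite_lists_length_eq by blast
  then have "finite (\<phi> ` {ys. set ys \<subseteq> f ` B \<and> length ys = Suc n})"
    by simp
  moreover have "(\<lambda>xs. \<phi> (map f xs)) ` {xs \<in> tuples n. set xs \<subseteq> B} \<subseteq> \<phi> ` {ys. set ys \<subseteq> f ` B \<and> length ys = Suc n}"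
    using tuplesD(1) set_map_discretization_subset by (intro image_subsetI imageI) simp
  ultimately show "finite ((\<lambda>xs. \<phi> (map f xs)) ` {xs \<in> tuples n. set xs \<subseteq> B})"
    by (rule rev_finite_subset)
qed

lemma discretized_tail_tuples:
  assumes "xs \<in> tuples n" "i \<le> n"
  shows "take (Suc i) xs @ map f (drop i xs) \<in> tuples (Suc n)"
proof -
  have "set (take (Suc i) xs) \<subseteq> M" "set (map f (drop i xs)) \<subseteq> M"
    using tuplesD(2)[OF assms(1)] discretizationD(1)[OF f] set_take_subset[of "Suc i" xs] set_drop_subset[of i xs]
    by (auto simp del: take_Suc)
  then show ?thesis
    using assms tuplesD(1)[OF assms(1)] by (simp add: tuples_def)
qed

text \<open>With the discretized tail held fixed, the map only copies entries and is continuous. The tails form a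
  countable set.\<close>

lemma measurable_discretized_tail:
  assumes "i \<le> n"
  shows "(\<lambda>xs. take (Suc i) xs @ map f (drop i xs)) \<in> measurable (tuple_borel n) (tuple_borel (Suc n))"
proof -
  let ?js = "[i..<Suc n]"
  let ?L = "{ys. set ys \<subseteq> f ` M \<and> length ys = length ?js}"
  have "(\<lambda>xs. take (Suc i) xs @ map (\<lambda>j. f (xs ! j)) ?js) \<in> measurable (tuple_borel n) (tuple_borel (Suc n))"
  proof (rule measurable_compose_countable'[where f = "\<lambda>ys xs. take (Suc i) xs @ ys" and I = ?L])
    show "countable ?L"
      by (rule countable_lists_discretization)
    show "(\<lambda>xs. map (\<lambda>j. f (xs ! j)) ?js) \<in> measurable (tuple_borel n) (count_space ?L)"
      by (rule measurable_map_discretization) auto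
    fix ys assume ys: "ys \<in> ?L"
    show "(\<lambda>xs. take (Suc i) xs @ ys) \<in> measurable (tuple_borel n) (tuple_borel (Suc n))"
    proof (rule measurable_continuous_tuples)
      have ys_M: "set ys \<subseteq> M"
        using ys discretizationD(1)[OF f] by blast
      have len: "length ys = Suc n - i"
        using ys by (simp del: upt_Suc)
      fix xs assume xs: "xs \<in> tuples n"
      have "set (take (Suc i) xs) \<subseteq> M"
        using tuplesD(2)[OF xs] set_take_subset[of "Suc i" xs] by (rule order_trans[rotated])
      then show "take (Suc i) xs @ ys \<in> tuples (Suc n)"
        using ys_M len tuplesD(1)[OF xs] assms by (simp add: tuples_def)
    next
      have len: "length ys = Suc n - i" and ys_M: "set ys \<subseteq> M"
        using ys discretizationD(1)[OF f] by (auto simp del: upt_Suc)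
      fix j assume j: "j \<le> Suc n"
      show "continuous_map (tuple_topology n) mtopology (\<lambda>xs. (take (Suc i) xs @ ys) ! j)"
      proof (cases "j \<le> i")
        case True
        then have eq: "xs ! j = (take (Suc i) xs @ ys) ! j" if "xs \<in> topspace (tuple_topology n)" for xs
          using tuplesD(1)[of xs n] that assms by (simp add: nth_append)
        have "continuous_map (tuple_topology n) mtopology (\<lambda>xs. xs ! j)"
          using True assms by (intro continuous_map_entry) simp
        then show ?thesis
          by (rule continuous_map_eq) (rule eq)
      next
        case False
        then have eq: "ys ! (j - Suc i) = (take (Suc i) xs @ ys) ! j" if "xs \<in> topspace (tuple_topology n)" for xs
          using tuplesD(1)[of xs n] that assms by (simp add: nth_append)
        have "ys ! (j - Suc i) \<in> M"
          using len j False assms by (intro subsetD[OF ys_M] nth_mem) simp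
        then have "continuous_map (tuple_topology n) mtopology (\<lambda>xs. ys ! (j - Suc i))"
          by simp
        then show ?thesis
          by (rule continuous_map_eq) (rule eq)
      qed
    qed
  qed
  moreover have "map (\<lambda>j. f (xs ! j)) ?js = map f (drop i xs)" if "xs \<in> tuples n" for xs
    using tuplesD(1)[OF that] by (intro nth_equalityI) (auto simp del: upt_Suc)
  ultimately show ?thesis
    using measurable_cong[of "tuple_borel n" "\<lambda>xs. take (Suc i) xs @ map f (drop i xs)"
        "\<lambda>xs. take (Suc i) xs @ map (\<lambda>j. f (xs ! j)) ?js"]
    by (simp del: upt_Suc)
qed

lemma regular_prism_discretization:
  assumes \<phi>: "regular (Suc n) \<phi>"
  shows "regular n (prism f \<phi>)"
proof -
  have "regular n (\<lambda>xs. \<phi> (take (Suc i) xs @ map f (drop i xs)))" if i: "i \<le> n" for i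
  proof (rule regular_compose[OF \<phi> measurable_discretized_tail[OF i]])
    fix B assume B: "mbounded B"
    have "f ` B \<subseteq> M"
      using mbounded_subset_mspace[OF B] discretizationD(1)[OF f] by auto
    then have "mbounded (B \<union> f ` B)"
      using B discretizationD(3)[OF f B] by (simp add: mbounded_Un finite_imp_mbounded)
    moreover have "set (take (Suc i) xs @ map f (drop i xs)) \<subseteq> B \<union> f ` B" if "set xs \<subseteq> B" for xs
      using that set_take_subset[of "Suc i" xs] set_drop_subset[of i xs] by (auto simp del: take_Suc)
    ultimately show "\<exists>B'. mbounded B' \<and>
        (\<forall>xs\<in>tuples n. set xs \<subseteq> B \<longrightarrow> set (take (Suc i) xs @ map f (drop i xs)) \<subseteq> B')"
      by blast
  qed
  then have "regular n (\<lambda>xs. \<Sum>i<Suc n. alt i (\<phi> (take (Suc i) xs @ map f (drop i xs))))"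
    by (intro regular_sum regular_alt) auto
  then show ?thesis
    by (rule iffD1[OF regular_cong, rotated]) (simp add: prism_def tuplesD(1))
qed

lemma prism_limit_coch:
  assumes \<phi>: "\<phi> \<in> limit_coch (Suc n)"
  shows "restrict_tuples (tuples n) (prism f \<phi>) \<in> limit_coch n"
proof (rule limit_coch_nearby[OF \<phi>])
  fix xs assume "restrict_tuples (tuples n) (prism f \<phi>) xs \<noteq> 0"
  then have xs: "xs \<in> tuples n" and "prism f \<phi> xs \<noteq> 0"
    by (auto simp: restrict_tuples_def split: if_splits)
  then obtain i where i: "i < length xs" "\<phi> (take (Suc i) xs @ map f (drop i xs)) \<noteq> 0"
    by (auto elim: prism_nonzeroE)
  have near: "d x (f x) < 1" "d x x < 1" if "x \<in> set xs" for x
    using discretizationD(2)[OF f] tuplesD(2)[OF xs] that by auto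
  have split: "set xs = set (take (Suc i) xs) \<union> set (drop i xs)"
  proof -
    have "set (take i xs) \<union> set (drop i xs) = set xs"
      by (metis append_take_drop_id set_append)
    then show ?thesis
      using set_take_subset_set_take[OF le_SucI[OF order_refl], of i xs] set_take_subset[of "Suc i" xs] by blast
  qed
  show "\<exists>ys. \<phi> ys \<noteq> 0 \<and> (\<forall>x\<in>set xs. \<exists>y\<in>set ys. d x y < 1) \<and> (\<forall>y\<in>set ys. \<exists>x\<in>set xs. d x y < 1)"
    using i(2) near split by (intro exI[of _ "take (Suc i) xs @ map f (drop i xs)"]) auto
qed (simp add: restrict_tuples_def)

lemma map_limit_coch:
  assumes \<phi>: "\<phi> \<in> limit_coch n"
  shows "restrict_tuples (tuples n) (\<lambda>xs. \<phi> (map f xs)) \<in> limit_coch n"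
proof (rule limit_coch_nearby[OF \<phi>])
  fix xs assume "restrict_tuples (tuples n) (\<lambda>xs. \<phi> (map f xs)) xs \<noteq> 0"
  then have xs: "xs \<in> tuples n" and "\<phi> (map f xs) \<noteq> 0"
    by (auto simp: restrict_tuples_def split: if_splits)
  moreover have "d x (f x) < 1" if "x \<in> set xs" for x
    using discretizationD(2)[OF f] tuplesD(2)[OF xs] that by auto
  ultimately show "\<exists>ys. \<phi> ys \<noteq> 0 \<and> (\<forall>x\<in>set xs. \<exists>y\<in>set ys. d x y < 1) \<and> (\<forall>y\<in>set ys. \<exists>x\<in>set xs. d x y < 1)"
    by (intro exI[of _ "map f xs"]) auto
qed (simp add: restrict_tuples_def)

end

section \<open>Roe's complex in the strict limit\<close>

lemma Coch_roe_complex: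
  assumes proper_metric
  shows "Coch roe_complex n = {\<phi> \<in> limit_coch n. regular n \<phi>}"
  using locally_bounded_iff[OF assms, of n]
  by (auto simp: roe_complex_def limit_coch_def regular_def bounded_support_on_iff)

lemma Diff_roe_complex: "Diff roe_complex n = tuple_diff (tuples (Suc n)) n"
  by (simp add: roe_complex_def)

lemma face_sum_on_tuples:
  assumes "\<And>ys. ys \<in> tuples n \<Longrightarrow> g ys = h ys" "xs \<in> tuples (Suc n)"
  shows "face_sum g xs = face_sum h xs"
  using assms omit_tuples by (intro face_sum_cong) blast

lemma cochain_complex_roe:
  assumes proper_metric
  shows "cochain_complex (roe_complex :: ('a list \<Rightarrow> 'b::ab_group_add) complex_of_groups)"
  unfolding cochain_complex_def Coch_roe_complex[OF assms] Diff_roe_complex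
proof (intro allI conjI ballI image_subsetI)
  fix n and \<phi> \<psi> :: "'a list \<Rightarrow> 'b"
  have "regular n (0 :: 'a list \<Rightarrow> 'b)"
    using regular_const[of n "0 :: 'b"] by (simp add: zero_fun_def)
  moreover have "restrict_tuples T 0 = (0 :: 'a list \<Rightarrow> 'b)" for T
    by (auto simp: restrict_tuples_def)
  then have "(0 :: 'a list \<Rightarrow> 'b) \<in> limit_coch n"
    by (simp add: limit_coch_def)
  moreover have "regular n (\<phi> - \<psi>)" if "regular n \<phi>" "regular n \<psi>" for \<phi> \<psi> :: "'a list \<Rightarrow> 'b"
    using regular_binop[OF that, of "(-)"] by (simp add: fun_diff_def)
  ultimately show "additive_subgroup {\<phi> \<in> limit_coch n. regular n (\<phi> :: 'a list \<Rightarrow> 'b)}"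
    by (simp add: additive_subgroup_def limit_coch_diff)
  show "tuple_diff (tuples (Suc n)) n (\<phi> + \<psi>) = tuple_diff (tuples (Suc n)) n \<phi> + tuple_diff (tuples (Suc n)) n \<psi>"
    by (auto simp: tuple_diff_eq face_sum_def alt_add sum.distrib)
  assume "\<phi> \<in> {\<phi> \<in> limit_coch n. regular n \<phi>}"
  then show "tuple_diff (tuples (Suc n)) n \<phi> \<in> {\<phi> \<in> limit_coch (Suc n). regular (Suc n) \<phi>}"
    by (simp add: limit_coch_tuple_diff regular_tuple_diff)
  have "face_sum (tuple_diff (tuples (Suc n)) n \<phi>) xs = face_sum (face_sum \<phi>) xs"
    if "xs \<in> tuples (Suc (Suc n))" for xs
    using that by (intro face_sum_on_tuples) (simp_all add: tuple_diff_eq)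
  then show "tuple_diff (tuples (Suc (Suc n))) (Suc n) (tuple_diff (tuples (Suc n)) n \<phi>) = 0"
    by (auto simp: tuple_diff_eq[of _ "Suc n"])
qed

text \<open>Let \<open>P\<close> be the prism operator of a discretization \<open>f\<close>, and let \<open>a\<close> be the differential of \<open>\<phi>\<close>. The
  homotopy formula reads \<open>\<phi> = (\<phi> \<circ> f - P a) - D (P \<phi>)\<close>, and the term in parentheses lies in Roe's
  complex if \<open>a\<close> does. The case distinction is needed because \<open>P \<phi>\<close> has degree one less than \<open>\<phi>\<close>; it is
  zero in degree zero.\<close>

lemma roe_approximation:
  assumes proper: proper_metric and \<phi>: "\<phi> \<in> limit_coch n"
    and d\<phi>: "tuple_diff (tuples (Suc n)) n \<phi> \<in> Coch roe_complex (Suc n)"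
  obtains \<phi>' where "\<phi>' \<in> Coch roe_complex n"
    "case n of 0 \<Rightarrow> \<phi> = \<phi>' | Suc k \<Rightarrow> \<exists>\<epsilon>\<in>limit_coch k. \<phi> - \<phi>' = tuple_diff (tuples n) k \<epsilon>"
proof -
  obtain f where f: "discretization f"
    using ex_discretization[OF proper] by blast
  let ?a = "tuple_diff (tuples (Suc n)) n \<phi>"
  let ?\<phi>' = "restrict_tuples (tuples n) (\<lambda>xs. \<phi> (map f xs)) - restrict_tuples (tuples n) (prism f ?a)"
  have a: "?a \<in> limit_coch (Suc n)" "regular (Suc n) ?a"
    using d\<phi> by (simp_all add: Coch_roe_complex[OF proper])
  have "regular n (\<lambda>xs. \<phi> (map f xs) - prism f ?a xs)"
    by (rule regular_binop[OF regular_map_discretization[OF f] regular_prism_discretization[OF f a(2)]])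
  then have "regular n ?\<phi>'"
    by (rule iffD1[OF regular_cong, rotated]) (simp add: restrict_tuples_def)
  moreover have "?\<phi>' \<in> limit_coch n"
    by (intro limit_coch_diff map_limit_coch[OF f \<phi>] prism_limit_coch[OF f a(1)])
  ultimately have \<phi>': "?\<phi>' \<in> Coch roe_complex n"
    by (simp add: Coch_roe_complex[OF proper])
  have eq: "\<phi> xs - ?\<phi>' xs = - face_sum (prism f \<phi>) xs" if xs: "xs \<in> tuples n" for xs
  proof -
    have "prism f ?a xs = prism f (face_sum \<phi>) xs"
    proof (rule prism_cong)
      fix i assume "i < length xs"
      then have "take (Suc i) xs @ map f (drop i xs) \<in> tuples (Suc n)"
        using xs by (intro discretized_tail_tuples[OF f]) (auto simp: tuplesD(1))
      then show "?a (take (Suc i) xs @ map f (drop i xs)) = face_sum \<phi> (take (Suc i) xs @ map f (drop i xs))"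
        by (simp add: tuple_diff_eq)
    qed
    then show ?thesis
      using prism_homotopy[of f \<phi> xs] xs by (simp add: restrict_tuples_def algebra_simps)
  qed
  have outside: "\<phi> xs = ?\<phi>' xs" if "xs \<notin> tuples n" for xs
    using that \<phi> by (simp add: limit_coch_def restrict_tuples_def)
  show thesis
  proof (cases n)
    case 0
    have "\<phi> xs = ?\<phi>' xs" for xs
    proof (cases "xs \<in> tuples n")
      case True
      then obtain x where "xs = [x]"
        using 0 by (auto simp: tuples_def length_Suc_conv)
      then show ?thesis
        using eq[OF True] by (simp add: face_sum_Cons)
    qed (rule outside)
    then have "\<phi> = ?\<phi>'"
      by blast
    then show thesis
      using that[OF \<phi>'] 0 by simp
  next
    case (Suc k)
    let ?P = "restrict_tuples (tuples k) (prism f \<phi>)"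
    have P: "?P \<in> limit_coch k"
      using prism_limit_coch[OF f] \<phi> Suc by blast
    have "0 - ?P \<in> limit_coch k"
      using limit_coch_diff[OF limit_coch_diff[OF P P] P] by simp
    moreover have "(\<phi> - ?\<phi>') xs = tuple_diff (tuples n) k (0 - ?P) xs" for xs
    proof (cases "xs \<in> tuples n")
      case True
      have "face_sum (0 - ?P) xs = face_sum (\<lambda>ys. - prism f \<phi> ys) xs"
        using True Suc by (intro face_sum_on_tuples[of k]) (simp_all add: restrict_tuples_def)
      then show ?thesis
        using eq[OF True] True Suc by (simp add: tuple_diff_eq face_sum_minus)
    next
      case False
      then show ?thesis
        using outside[OF False] Suc by (simp add: tuple_diff_eq)
    qed
    then have "\<phi> - ?\<phi>' = tuple_diff (tuples n) k (0 - ?P)"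
      by (rule ext)
    ultimately show thesis
      using that[OF \<phi>'] Suc by auto
  qed
qed

section \<open>The homotopy limit in coordinates\<close>

lemma chain_list_omit:
  fixes I :: "'i::order set"
  assumes "chain_list I s" "1 < length s"
  shows "chain_list I (omit i s)" "hd s \<le> hd (omit i s)" "i \<noteq> 0 \<Longrightarrow> hd (omit i s) = hd s"
proof -
  obtain a b t where s: "s = a # b # t"
    using assms(2) by (metis One_nat_def length_0_conv length_Cons less_irrefl list.exhaust list.size(3) not_less_zero)
  have sorted: "sorted_wrt (\<le>) (omit i s)" if "sorted_wrt (\<le>) s" for s :: "'i list" and i
    using that
  proof (induction s arbitrary: i)
    case (Cons x s)
    then show ?case
      using set_omit_subset[of _ s] by (cases i) auto
  qed (simp add: omit_def)
  have "omit i s \<noteq> []"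
    unfolding s by (cases i) auto
  then show "chain_list I (omit i s)"
    using assms(1) sorted[of s i] set_omit_subset[of i s] by (auto simp: chain_list_def)
  show "hd s \<le> hd (omit i s)" "i \<noteq> 0 \<Longrightarrow> hd (omit i s) = hd s"
    using assms(1) by (cases i; simp add: s chain_list_def)+
qed

text \<open>The positions at which a cochain of the homotopy limit can be nonzero. A chain of length \<open>p + 1\<close> and a
  tuple of length \<open>n + 1\<close> occur together in total degree \<open>p + n\<close>, so total degree \<open>m\<close> corresponds to
  \<open>k = m + 2\<close>.\<close>

definition cell :: "nat \<Rightarrow> ('a \<times> 'a) set list \<Rightarrow> 'a list \<Rightarrow> bool" where
  "cell k s xs \<longleftrightarrow> chain_list full_entourages s \<and> xs \<noteq> [] \<and> set xs \<subseteq> M \<and> pairs xs \<subseteq> hd s \<and>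
     length s + length xs = k"

lemma cellD:
  assumes "cell k s xs"
  shows "chain_list full_entourages s" "xs \<noteq> []" "set xs \<subseteq> M" "pairs xs \<subseteq> hd s" "s \<noteq> []"
    "length s + length xs = k"
  using assms by (auto simp: cell_def chain_list_def)

lemma cell_omit_chain:
  assumes "cell (Suc k) s xs" "1 < length s" "i < length s"
  shows "cell k (omit i s) xs"
  using assms chain_list_omit[of full_entourages s i] by (auto simp: cell_def length_omit)

lemma cell_omit_tuple:
  assumes "cell (Suc k) s xs" "1 < length xs" "i < length xs"
  shows "cell k s (omit i xs)"
proof -
  have "omit i xs \<noteq> []"
    using assms length_omit[of i xs] by auto
  then show ?thesis
    using assms set_omit_subset[of i xs] pairs_omit_subset[of xs "hd s" i]
    by (auto simp: cell_def length_omit)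
qed

lemma cell_iff_controlled:
  assumes "chain_list full_entourages s" "length s \<le> Suc m"
  shows "xs \<in> controlled_tuples (hd s) (Suc m - length s) \<longleftrightarrow> cell (m + 2) s xs"
proof -
  have "length xs = Suc (Suc m - length s) \<longleftrightarrow> length s + length xs = m + 2"
    using assms(2) by auto
  then show ?thesis
    using assms by (auto simp: controlled_tuples_iff cell_def tuples_def)
qed

lemma chain_hd_strip:
  assumes "chain_list full_entourages s"
  obtains r where "hd s \<subseteq> strip r"
proof -
  have "hd s \<in> full_entourages"
    using assms hd_in_set[of s] by (auto simp: chain_list_def)
  then show thesis
    using that by (auto simp: full_entourages_def entourages_def)
qed

lemma Coch_coarse:
  "c \<in> Coch coarse_cohomology_complex m \<longleftrightarrow>
    (\<forall>s xs. \<not> cell (m + 2) s xs \<longrightarrow> c s xs = 0) \<and> (\<forall>s. bounded_support (c s))"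
proof -
  have "(if chain_list full_entourages s \<and> length s \<le> Suc m
      then c s \<in> Coch (controlled_complex (hd s)) (Suc m - length s) else c s = 0) \<longleftrightarrow>
    (\<forall>xs. \<not> cell (m + 2) s xs \<longrightarrow> c s xs = 0) \<and> bounded_support (c s)" for s
  proof (cases "chain_list full_entourages s \<and> length s \<le> Suc m")
    case True
    let ?T = "controlled_tuples (hd s) (Suc m - length s)"
    have "restrict_tuples ?T (c s) = c s" if "\<forall>xs. xs \<notin> ?T \<longrightarrow> c s xs = 0"
      using that by (auto simp: restrict_tuples_def)
    then show ?thesis
      using True cell_iff_controlled[of s m] by (auto simp: controlled_complex_def bounded_support_on_iff)
  next
    case False
    then have "\<not> cell (m + 2) s xs" for xs
      by (cases xs) (auto simp: cell_def)
    then show ?thesis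
      using False by (auto simp: fun_eq_iff bounded_support_def)
  qed
  then show ?thesis
    unfolding coarse_cohomology_complex_def holim_def holim_coch_def by auto
qed

lemma Coch_coarseD:
  assumes "c \<in> Coch coarse_cohomology_complex m"
  shows "\<not> cell (m + 2) s xs \<Longrightarrow> c s xs = 0" "bounded_support (c s)" "c [] = 0" "c s [] = 0"
  using assms by (auto simp: Coch_coarse cell_def chain_list_def fun_eq_iff)

text \<open>The total differential without the case distinctions for chains and tuples with a single entry. These
  cases take care of themselves because cochains vanish on empty lists.\<close>

definition total_diff ::
  "(('a \<times> 'a) set list \<Rightarrow> 'a list \<Rightarrow> 'b::ab_group_add) \<Rightarrow> (('a \<times> 'a) set list \<Rightarrow> 'a list \<Rightarrow> 'b)" where
  "total_diff c s xs = face_sum (\<lambda>t. c t xs) s + alt (length s - 1) (face_sum (c s) xs)"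

lemma Diff_coarse:
  assumes c: "c \<in> Coch coarse_cohomology_complex m"
  shows "Diff coarse_cohomology_complex m c =
    (\<lambda>s xs. if cell (m + 3) s xs then total_diff c s xs else 0)"
proof (intro ext)
  fix s xs
  show "Diff coarse_cohomology_complex m c s xs = (if cell (m + 3) s xs then total_diff c s xs else 0)"
  proof (cases "chain_list full_entourages s \<and> length s \<le> Suc (Suc m)")
    case False
    then have "\<not> cell (m + 3) s xs"
      by (cases xs) (auto simp: cell_def)
    then show ?thesis
      using False by (auto simp: coarse_cohomology_complex_def holim_def holim_diff_def)
  next
    case True
    define p where "p = length s - 1"
    have s: "chain_list full_entourages s" "s \<noteq> []" "length s = Suc p" "p \<le> Suc m" "s ! 0 = hd s"
      using True by (auto simp: p_def chain_list_def hd_conv_nth)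
    have cell: "xs \<in> controlled_tuples (hd s) (Suc m - p) \<longleftrightarrow> cell (m + 3) s xs"
      using cell_iff_controlled[of s "Suc m" xs] s by (simp add: eval_nat_numeral)
    let ?A = "if 1 \<le> p then restrict_tuples (controlled_tuples (s ! 0) (Suc m - p)) (c (omit 0 s)) xs +
        (\<Sum>i=1..p. alt i (c (omit i s) xs)) else 0"
    let ?B = "if p \<le> m then alt p (tuple_diff (controlled_tuples (hd s) (Suc (m - p))) (m - p) (c s) xs) else 0"
    have "Diff coarse_cohomology_complex m c s xs = ?A + ?B"
      using True
      by (simp add: coarse_cohomology_complex_def holim_def holim_diff_def p_def[symmetric] controlled_complex_def
          sum_fun_apply alt_fun_apply del: One_nat_def)
    moreover have "?A = (if cell (m + 3) s xs then face_sum (\<lambda>t. c t xs) s else 0)"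
    proof (cases "1 \<le> p")
      case False
      then have "length s = Suc 0"
        using s(3) by simp
      then obtain U where "s = [U]"
        by (auto simp: length_Suc_conv)
      then show ?thesis
        using False Coch_coarseD(3)[OF c] by (simp add: face_sum_Cons)
    next
      case p: True
      show ?thesis
      proof (cases "cell (m + 3) s xs")
        case True
        have "{..<length s} = insert 0 {1..p}"
          using s by auto
        then have "face_sum (\<lambda>t. c t xs) s = c (omit 0 s) xs + (\<Sum>i=1..p. alt i (c (omit i s) xs))"
          by (simp add: face_sum_def)
        then show ?thesis
          using p True cell s by (simp add: restrict_tuples_def)
      next
        case False
        have "c (omit i s) xs = 0" if i: "i \<in> {1..p}" for i
        proof (rule Coch_coarseD(1)[OF c])
          have "hd (omit i s) = hd s" "length (omit i s) = length s - 1"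
            using chain_list_omit(3)[OF s(1), of i] i p s by (auto simp: length_omit)
          then show "\<not> cell (m + 2) (omit i s) xs"
            using False s i by (auto simp: cell_def)
        qed
        then show ?thesis
          using False cell s by (simp add: restrict_tuples_def)
      qed
    qed
    moreover have "?B = (if cell (m + 3) s xs then alt p (face_sum (c s) xs) else 0)"
    proof (cases "p \<le> m")
      case True
      then have "Suc (m - p) = Suc m - p"
        by simp
      moreover have "controlled_tuples (hd s) (Suc (m - p)) \<subseteq> tuples (Suc (m - p))"
        by (auto simp: controlled_tuples_iff)
      ultimately show ?thesis
        using True cell by (simp add: tuple_diff_eq)
    next
      case False
      have "face_sum (c s) xs = 0" if "cell (m + 3) s xs"
      proof -
        have "length xs = 1"
          using cellD(6)[OF that] s False by simp
        then obtain x where "xs = [x]"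
          by (auto simp: length_Suc_conv)
        then show ?thesis
          using Coch_coarseD(4)[OF c] by (simp add: face_sum_Cons)
      qed
      then show ?thesis
        using False by simp
    qed
    ultimately show ?thesis
      by (simp add: total_diff_def p_def)
  qed
qed

lemma Coch_coarse_diff:
  assumes "a \<in> Coch coarse_cohomology_complex m" "b \<in> Coch coarse_cohomology_complex m"
  shows "a - b \<in> Coch coarse_cohomology_complex m"
proof -
  have "bounded_support ((a - b) s)" for s
    by (rule bounded_support_either[OF Coch_coarseD(2)[OF assms(1), of s] Coch_coarseD(2)[OF assms(2), of s]]) auto
  then show ?thesis
    unfolding Coch_coarse[of "a - b"]
    using Coch_coarseD(1)[OF assms(1)] Coch_coarseD(1)[OF assms(2)] by simp
qed

lemma zero_Coch_coarse: "0 \<in> Coch coarse_cohomology_complex m"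
  by (simp add: Coch_coarse)

lemma Diff_coarse_in_Coch:
  assumes c: "c \<in> Coch coarse_cohomology_complex m"
  shows "Diff coarse_cohomology_complex m c \<in> Coch coarse_cohomology_complex (Suc m)"
proof -
  have "bounded_support (\<lambda>xs. if cell (m + 3) s xs then total_diff c s xs else 0)" for s
  proof (cases "chain_list full_entourages s")
    case True
    then obtain r where r: "hd s \<subseteq> strip r"
      by (rule chain_hd_strip)
    let ?h = "\<lambda>xs. if cell (m + 3) s xs then face_sum (\<lambda>t. c t xs) s else 0"
    let ?k = "\<lambda>xs. if cell (m + 3) s xs then face_sum (c s) xs else 0"
    have h: "bounded_support ?h"
    proof (rule bounded_support_dominated_same[of "{..<length s}" "\<lambda>i. c (omit i s)"])
      fix xs assume "?h xs \<noteq> 0"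
      then have "cell (m + 3) s xs" "face_sum (\<lambda>t. c t xs) s \<noteq> 0"
        by (auto split: if_splits)
      then show "set xs \<subseteq> M \<and> (\<exists>j\<in>{..<length s}. c (omit j s) xs \<noteq> 0)"
        using cellD(3) by (auto elim!: face_sum_nonzeroE)
    qed (use Coch_coarseD(2)[OF c] in auto)
    have k: "bounded_support ?k"
    proof (rule bounded_support_face_sum[OF Coch_coarseD(2,4)[OF c]])
      fix xs assume "?k xs \<noteq> 0"
      then have "cell (m + 3) s xs" "face_sum (c s) xs \<noteq> 0"
        by (auto split: if_splits)
      then show "pairs xs \<subseteq> strip r \<and> face_sum (c s) xs \<noteq> 0"
        using cellD(4) r by blast
    qed
    show ?thesis
      by (rule bounded_support_either[OF h k]) (auto simp: total_diff_def split: if_splits)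
  next
    case False
    then show ?thesis
      by (simp add: cell_def)
  qed
  then show ?thesis
    unfolding Diff_coarse[OF c] by (simp add: Coch_coarse eval_nat_numeral)
qed

text \<open>Omitting an entry of the chain changes the parity of its length, so the two mixed terms cancel. For a
  chain with one entry both mixed terms refer to the empty chain.\<close>

lemma total_diff_total_diff:
  fixes c :: "('a \<times> 'a) set list \<Rightarrow> 'a list \<Rightarrow> 'b::ab_group_add"
  assumes "c [] = 0"
  shows "total_diff (total_diff c) s xs = 0"
proof -
  have eq: "total_diff (total_diff c) s xs =
    face_sum (\<lambda>t. alt (length t - 1) (face_sum (c t) xs)) s +
    alt (length s - 1) (face_sum (\<lambda>ys. face_sum (\<lambda>t. c t ys) s) xs)"
    unfolding total_diff_def[abs_def] face_sum_add alt_add face_sum_alt face_sum_face_sum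
    by simp
  show ?thesis
  proof (cases "1 < length s")
    case True
    have "face_sum (\<lambda>t. alt (length t - 1) (face_sum (c t) xs)) s =
      face_sum (\<lambda>t. alt (length s - 2) (face_sum (c t) xs)) s"
      by (rule face_sum_cong) (simp add: length_omit numeral_2_eq_2)
    moreover obtain l where "length s = Suc (Suc l)"
      using True by (cases s; cases "tl s") auto
    ultimately show ?thesis
      unfolding eq face_sum_alt by (subst face_sum_commute) simp
  next
    case False
    then consider "s = []" | U where "s = [U]"
      by (cases s) auto
    then show ?thesis
      using assms unfolding eq by cases (simp_all add: face_sum_Cons)
  qed
qed

lemma cochain_complex_coarse:
  "cochain_complex (coarse_cohomology_complex :: (('a \<times> 'a) set list \<Rightarrow> 'a list \<Rightarrow> 'b::ab_group_add) complex_of_groups)"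
  unfolding cochain_complex_def
proof (intro allI conjI ballI image_subsetI)
  let ?C = "coarse_cohomology_complex :: (('a \<times> 'a) set list \<Rightarrow> 'a list \<Rightarrow> 'b::ab_group_add) complex_of_groups"
  fix m
  show "additive_subgroup (Coch ?C m)"
    by (simp add: additive_subgroup_def Coch_coarse_diff zero_Coch_coarse)
  fix c assume c: "c \<in> Coch ?C m"
  show Dc: "Diff ?C m c \<in> Coch ?C (Suc m)"
    by (rule Diff_coarse_in_Coch[OF c])
  show "Diff ?C (Suc m) (Diff ?C m c) = 0"
  proof (intro ext)
    fix s xs
    have left: "Diff ?C m c (omit i s) xs = total_diff c (omit i s) xs"
      if "cell (Suc (m + 3)) s xs" "i < length s" for i
    proof (cases "1 < length s")
      case True
      then show ?thesis
        using cell_omit_chain[OF that(1) True that(2)] by (simp add: Diff_coarse[OF c])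
    next
      case False
      then have "omit i s = []"
        using that(2) length_omit[of i s] by auto
      then show ?thesis
        using Coch_coarseD(3)[OF c] Coch_coarseD(3)[OF Dc] by (simp add: total_diff_def zero_fun_def)
    qed
    have right: "Diff ?C m c s (omit i xs) = total_diff c s (omit i xs)"
      if "cell (Suc (m + 3)) s xs" "i < length xs" for i
    proof (cases "1 < length xs")
      case True
      then show ?thesis
        using cell_omit_tuple[OF that(1) True that(2)] by (simp add: Diff_coarse[OF c])
    next
      case False
      then have "omit i xs = []"
        using that(2) length_omit[of i xs] by auto
      then show ?thesis
        using Coch_coarseD(4)[OF c] Coch_coarseD(4)[OF Dc] by (simp add: total_diff_def)
    qed
    have "total_diff (Diff ?C m c) s xs = total_diff (total_diff c) s xs" if "cell (Suc (m + 3)) s xs"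
      unfolding total_diff_def[of "Diff ?C m c"] total_diff_def[of "total_diff c"]
      using face_sum_cong[of s "\<lambda>t. Diff ?C m c t xs" "\<lambda>t. total_diff c t xs"]
        face_sum_cong[of xs "Diff ?C m c s" "total_diff c s"] left[OF that] right[OF that] by metis
    then show "Diff ?C (Suc m) (Diff ?C m c) s xs = 0 s xs"
      using total_diff_total_diff[of c s xs] Coch_coarseD(3)[OF c] by (simp add: Diff_coarse[OF Dc])
  qed
  fix c' assume c': "c' \<in> Coch ?C m"
  have cc': "c + c' \<in> Coch ?C m"
    using Coch_coarse_diff[OF c Coch_coarse_diff[OF zero_Coch_coarse c']] by simp
  show "Diff ?C m (c + c') = Diff ?C m c + Diff ?C m c'"
    unfolding Diff_coarse[OF c] Diff_coarse[OF c'] Diff_coarse[OF cc']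
    by (auto simp: fun_eq_iff total_diff_def face_sum_def alt_add sum.distrib alt_sum)
qed

section \<open>Acyclicity in the direction of the entourages\<close>

text \<open>The width is a positive integer: positive, so that the strip contains the diagonal, and integral, so
  that subsets of a given strip have finitely many hulls.\<close>

definition strip_hull :: "('a \<times> 'a) set \<Rightarrow> ('a \<times> 'a) set" where
  "strip_hull W = strip (real (Suc (LEAST n. W \<subseteq> strip (real (Suc n)))))"

lemma ex_strip:
  assumes "W \<in> entourages"
  shows "\<exists>n. W \<subseteq> strip (real (Suc n))"
proof -
  obtain r where r: "W \<subseteq> strip r"
    using assms by (auto simp: entourages_def)
  obtain n :: nat where "r \<le> real n"
    using real_arch_simple by metis
  then have "strip r \<subseteq> strip (real (Suc n))"
    by (intro strip_mono) simp
  then show ?thesis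
    using r by blast
qed

lemma strip_hull_upper: "W \<in> entourages \<Longrightarrow> W \<subseteq> strip_hull W"
  unfolding strip_hull_def by (rule LeastI_ex[OF ex_strip])

lemma strip_hull_mono:
  assumes "W \<subseteq> W'" "W' \<in> entourages"
  shows "strip_hull W \<subseteq> strip_hull W'"
proof -
  let ?n = "LEAST n. W' \<subseteq> strip (real (Suc n))"
  have "W \<subseteq> strip (real (Suc ?n))"
    using LeastI_ex[OF ex_strip[OF assms(2)]] assms(1) by (rule order_trans[rotated])
  then have "(LEAST n. W \<subseteq> strip (real (Suc n))) \<le> ?n"
    by (rule Least_le)
  then show ?thesis
    unfolding strip_hull_def by (intro strip_mono) simp
qed

lemma strip_full: "r > 0 \<Longrightarrow> strip r \<in> full_entourages"
  by (auto simp: full_entourages_def entourages_def strip_def)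

lemma strip_hull_full: "strip_hull W \<in> full_entourages"
  unfolding strip_hull_def by (rule strip_full) simp

lemma full_entourages_entourages: "U \<in> full_entourages \<Longrightarrow> U \<in> entourages"
  by (simp add: full_entourages_def)

lemma finite_strip_hulls: "finite {strip_hull W | W. W \<subseteq> strip r}"
proof -
  obtain n :: nat where n: "r \<le> real n"
    using real_arch_simple by metis
  have "strip_hull W \<in> (\<lambda>k. strip (real (Suc k))) ` {..n}" if "W \<subseteq> strip r" for W
  proof -
    have "strip r \<subseteq> strip (real (Suc n))"
      using n by (intro strip_mono) simp
    then have "(LEAST n. W \<subseteq> strip (real (Suc n))) \<le> n"
      using that by (intro Least_le) (rule order_trans)
    then show ?thesis
      by (auto simp: strip_hull_def)
  qed
  then have "{strip_hull W | W. W \<subseteq> strip r} \<subseteq> (\<lambda>k. strip (real (Suc k))) ` {..n}"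
    by blast
  then show ?thesis
    by (rule finite_subset) simp
qed

lemma pairs_entourage:
  assumes "set xs \<subseteq> M"
  shows "pairs xs \<in> entourages"
proof -
  have "bdd_above ((\<lambda>(x, y). d x y) ` pairs xs)"
    by (simp add: pairs_def)
  then obtain b where b: "\<And>x y. x \<in> set xs \<Longrightarrow> y \<in> set xs \<Longrightarrow> d x y \<le> b"
    by (auto simp: bdd_above_def pairs_def)
  have "pairs xs \<subseteq> strip (max b 0 + 1)"
  proof
    fix q assume "q \<in> pairs xs"
    then obtain x y where "q = (x, y)" "x \<in> set xs" "y \<in> set xs"
      by (auto simp: pairs_def)
    then show "q \<in> strip (max b 0 + 1)"
      using b[of x y] assms by (auto simp: strip_def)
  qed
  then show ?thesis
    unfolding entourages_def by (intro CollectI exI[of _ "max b 0 + 1"]) simp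
qed

lemma sorted_wrt_map_mono:
  assumes "sorted_wrt (\<subseteq>) s" "set s \<subseteq> entourages"
  shows "sorted_wrt (\<subseteq>) (map strip_hull s)"
  using assms
proof (induction s)
  case (Cons x s)
  have "strip_hull x \<subseteq> strip_hull y" if "y \<in> set s" for y
    using Cons.prems that by (intro strip_hull_mono) auto
  then show ?case
    using Cons by simp
qed simp

text \<open>The hull of the pairs of \<open>xs\<close> need not be contained in \<open>hd s\<close>. By monotonicity it is contained in the
  hull of \<open>hd s\<close>, so it can be put in front of the chain of hulls.\<close>

lemma cell_hull_chain:
  assumes "cell k s xs"
  shows "cell (Suc k) (strip_hull (pairs xs) # map strip_hull s) xs"
proof -
  note c = cellD[OF assms]
  have s: "s \<noteq> []" "sorted_wrt (\<subseteq>) s" "set s \<subseteq> entourages"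
    using c(1) full_entourages_entourages by (auto simp: chain_list_def)
  have "pairs xs \<subseteq> u" if "u \<in> set s" for u
  proof (cases s)
    case (Cons v t)
    then show ?thesis
      using that c(4) s(2) by auto
  qed (use s in simp)
  then have "strip_hull (pairs xs) \<subseteq> strip_hull u" if "u \<in> set s" for u
    using that s(3) by (intro strip_hull_mono) auto
  then have "chain_list full_entourages (strip_hull (pairs xs) # map strip_hull s)"
    using sorted_wrt_map_mono[OF s(2,3)] strip_hull_full by (auto simp: chain_list_def)
  moreover have "pairs xs \<subseteq> strip_hull (pairs xs)"
    by (intro strip_hull_upper pairs_entourage c(3))
  ultimately show ?thesis
    using c by (simp add: cell_def)
qed

lemma cell_prism_chain:
  assumes "cell k s xs" "i < length s"
  shows "cell (Suc k) (take (Suc i) s @ map strip_hull (drop i s)) xs"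
proof -
  note c = cellD[OF assms(1)]
  have s: "sorted_wrt (\<subseteq>) s" "set s \<subseteq> full_entourages" "set s \<subseteq> entourages"
    using c(1) full_entourages_entourages by (auto simp: chain_list_def)
  let ?t = "take (Suc i) s @ map strip_hull (drop i s)"
  have "u \<subseteq> strip_hull v" if uv: "u \<in> set (take (Suc i) s)" "v \<in> set (drop i s)" for u v
  proof -
    obtain j where j: "j < Suc i" "j < length s" "u = s ! j"
      using uv(1) by (auto simp: in_set_conv_nth)
    obtain l where "l < length s - i" "v = s ! (i + l)"
      using uv(2) by (auto simp: in_set_conv_nth)
    then have l: "i + l < length s" "v = s ! (i + l)"
      by simp_all
    have "u \<subseteq> v"
    proof (cases "j = i + l")
      case False
      then show ?thesis
        using sorted_wrt_nth_less[OF s(1), of j "i + l"] j l by simp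
    qed (use j l in simp)
    also have "v \<subseteq> strip_hull v"
      using l s(3) by (intro strip_hull_upper) auto
    finally show ?thesis .
  qed
  moreover have "sorted_wrt (\<subseteq>) (map strip_hull (drop i s))"
    using s set_drop_subset[of i s] by (intro sorted_wrt_map_mono sorted_wrt_drop) auto
  ultimately have "sorted_wrt (\<subseteq>) ?t"
    using sorted_wrt_take[OF s(1)] by (auto simp: sorted_wrt_append simp del: take_Suc)
  moreover have "set ?t \<subseteq> full_entourages"
    using s(2) strip_hull_full set_take_subset[of "Suc i" s] by (auto simp del: take_Suc)
  moreover have "?t \<noteq> []" "hd ?t = hd s"
    using c(5) by (cases s; simp)+
  ultimately show ?thesis
    using c assms(2) by (simp add: cell_def chain_list_def del: take_Suc)
qed

text \<open>The sum of two homotopies: the prism operator deforms the identity to the operation induced by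
  \<open>strip_hull\<close>, and putting the hull of the pairs of \<open>xs\<close> in front contracts the latter.\<close>

definition cone_homotopy ::
  "'a list \<Rightarrow> (('a \<times> 'a) set list \<Rightarrow> 'b::ab_group_add) \<Rightarrow> ('a \<times> 'a) set list \<Rightarrow> 'b" where
  "cone_homotopy xs g s = g (strip_hull (pairs xs) # map strip_hull s) - prism strip_hull g s"

lemma cone_homotopy:
  assumes g: "\<And>t. cell (Suc k) t xs \<Longrightarrow> face_sum g t = 0" and s: "cell k s xs"
  shows "g s = face_sum (cone_homotopy xs g) s"
proof -
  let ?V = "strip_hull (pairs xs)"
  have "prism strip_hull (face_sum g) s = prism strip_hull (\<lambda>t. 0) s"
    using g cell_prism_chain[OF s] by (intro prism_cong) blast
  then have "prism strip_hull (face_sum g) s = 0"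
    by (simp add: prism_def)
  then have "face_sum (prism strip_hull g) s = g (map strip_hull s) - g s"
    using prism_homotopy[of strip_hull g s] by simp
  moreover have "face_sum g (?V # map strip_hull s) = 0"
    using g cell_hull_chain[OF s] by blast
  then have "g (map strip_hull s) = face_sum (\<lambda>t. g (?V # map strip_hull t)) s"
    by (simp add: face_sum_Cons face_sum_map)
  ultimately show ?thesis
    unfolding cone_homotopy_def[abs_def] face_sum_diff by simp
qed

definition contraction ::
  "nat \<Rightarrow> (('a \<times> 'a) set list \<Rightarrow> 'a list \<Rightarrow> 'b::ab_group_add) \<Rightarrow> ('a \<times> 'a) set list \<Rightarrow> 'a list \<Rightarrow> 'b" where
  "contraction m b s xs = (if cell (m + 2) s xs then cone_homotopy xs (\<lambda>t. b t xs) s else 0)"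

text \<open>The value at \<open>xs\<close> is a sum of values at \<open>xs\<close> of \<open>b\<close> on certain chains. For fixed \<open>s\<close>, these chains
  range over a finite set, because the tuples controlled by \<open>hd s\<close> have finitely many hulls.\<close>

lemma contraction_in_Coch:
  assumes b: "b \<in> Coch coarse_cohomology_complex (Suc m)"
  shows "contraction m b \<in> Coch coarse_cohomology_complex m"
proof -
  have "bounded_support (contraction m b s)" for s
  proof (cases "chain_list full_entourages s")
    case False
    then have "contraction m b s = 0"
      by (auto simp: contraction_def cell_def)
    then show ?thesis
      by simp
  next
    case True
    then obtain r where r: "hd s \<subseteq> strip r"
      by (rule chain_hd_strip)
    let ?J = "(\<lambda>V. V # map strip_hull s) ` {strip_hull W | W. W \<subseteq> strip r} \<union>
      (\<lambda>i. take (Suc i) s @ map strip_hull (drop i s)) ` {..<length s}"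
    show ?thesis
    proof (rule bounded_support_dominated_same[of ?J b])
      show "finite ?J"
        using finite_strip_hulls by simp
      show "bounded_support (b t)" for t
        by (rule Coch_coarseD(2)[OF b])
      fix xs assume nz: "contraction m b s xs \<noteq> 0"
      then have cell: "cell (m + 2) s xs"
        by (auto simp: contraction_def split: if_splits)
      have "\<exists>t\<in>?J. b t xs \<noteq> 0"
      proof (cases "b (strip_hull (pairs xs) # map strip_hull s) xs = 0")
        case True
        then have "prism strip_hull (\<lambda>t. b t xs) s \<noteq> 0"
          using nz cell by (simp add: contraction_def cone_homotopy_def)
        then obtain i where "i < length s" "b (take (Suc i) s @ map strip_hull (drop i s)) xs \<noteq> 0"
          by (rule prism_nonzeroE)
        then show ?thesis
          by blast
      next
        case False
        moreover have "pairs xs \<subseteq> strip r"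
          using cellD(4)[OF cell] r by (rule order_trans)
        ultimately show ?thesis
          by blast
      qed
      then show "set xs \<subseteq> M \<and> (\<exists>t\<in>?J. b t xs \<noteq> 0)"
        using cellD(3)[OF cell] by blast
    qed
  qed
  then show ?thesis
    by (simp add: Coch_coarse contraction_def)
qed

text \<open>Suppose that \<open>b\<close> vanishes on chains with more than \<open>q + 2\<close> entries. Its component on chains with
  \<open>q + 2\<close> entries is then a cocycle in the direction of the chains, since the other contribution to the
  total differential comes from the component of \<open>b\<close> on chains with one more entry. The contraction
  provides a primitive, and the total differential of the primitive has no components on chains with
  more than \<open>q + 2\<close> entries.\<close>

lemma contraction_top:
  assumes b: "b \<in> Coch coarse_cohomology_complex (Suc m)"
    and Db: "\<And>s. 1 < length s \<Longrightarrow> Diff coarse_cohomology_complex (Suc m) b s = 0"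
    and top: "\<And>s. Suc (Suc q) < length s \<Longrightarrow> b s = 0"
    and s: "Suc q < length s"
  shows "(b - Diff coarse_cohomology_complex m (contraction m b)) s = 0"
proof (rule ext)
  fix xs
  let ?C = "coarse_cohomology_complex"
  have K: "contraction m b \<in> Coch ?C m"
    by (rule contraction_in_Coch[OF b])
  have K_zero: "contraction m b t ys = 0" if "Suc q < length t" for t ys
  proof -
    have "b (strip_hull (pairs ys) # map strip_hull t) = 0"
      using that by (intro top) simp
    moreover have "prism strip_hull (\<lambda>u. b u ys) t = prism strip_hull (\<lambda>u. 0) t"
      using that by (intro prism_cong) (simp add: top)
    ultimately show ?thesis
      by (simp add: contraction_def cone_homotopy_def prism_def)
  qed
  show "(b - Diff ?C m (contraction m b)) s xs = 0 xs"
  proof (cases "cell (Suc m + 2) s xs")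
    case False
    then show ?thesis
      using Coch_coarseD(1)[OF b False] by (simp add: Diff_coarse[OF K] eval_nat_numeral)
  next
    case cell: True
    have "face_sum (contraction m b s) xs = 0"
      using K_zero[OF s] by (simp add: face_sum_def)
    then have "Diff ?C m (contraction m b) s xs = face_sum (\<lambda>t. contraction m b t xs) s"
      using cell by (simp add: Diff_coarse[OF K] total_diff_def eval_nat_numeral)
    also have "\<dots> = b s xs"
    proof (cases "Suc (Suc q) < length s")
      case True
      then have "face_sum (\<lambda>t. contraction m b t xs) s = face_sum (\<lambda>t. 0) s"
        by (intro face_sum_cong K_zero) (simp add: length_omit)
      then show ?thesis
        using top[OF True] by simp
    next
      case False
      have "face_sum (\<lambda>u. b u xs) t = 0" if t: "cell (Suc (Suc m + 2)) t xs" for t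
      proof -
        have len: "Suc (Suc q) < length t"
          using cellD(6)[OF t] cellD(6)[OF cell] s by simp
        then have "Diff ?C (Suc m) b t xs = face_sum (\<lambda>u. b u xs) t + alt (length t - 1) (face_sum (b t) xs)"
          using t by (simp add: Diff_coarse[OF b] total_diff_def eval_nat_numeral)
        moreover have "face_sum (b t) xs = 0"
          using top[OF len] by (simp add: face_sum_def)
        ultimately show ?thesis
          using Db[of t] len by simp
      qed
      then have "b s xs = face_sum (cone_homotopy xs (\<lambda>u. b u xs)) s"
        by (rule cone_homotopy[OF _ cell])
      also have "\<dots> = face_sum (\<lambda>t. contraction m b t xs) s"
      proof (rule face_sum_cong)
        fix i assume "i < length s"
        then have "cell (m + 2) (omit i s) xs"
          using cell s by (intro cell_omit_chain) auto
        then show "cone_homotopy xs (\<lambda>u. b u xs) (omit i s) = contraction m b (omit i s) xs"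
          by (simp add: contraction_def)
      qed
      finally show ?thesis
        by simp
    qed
    finally show ?thesis
      by simp
  qed
qed

lemma coboundary_coarse:
  assumes "e \<in> coboundaries coarse_cohomology_complex m"
  shows "e \<in> Coch coarse_cohomology_complex m" "Diff coarse_cohomology_complex m e = 0"
  using coboundary_in_Coch[OF cochain_complex_coarse assms] by blast+

lemmas Diff_coarse_diff = Diff_diff[OF cochain_complex_coarse]

lemma staircase:
  fixes b :: "('a \<times> 'a) set list \<Rightarrow> 'a list \<Rightarrow> 'b::ab_group_add"
  assumes "b \<in> Coch coarse_cohomology_complex m"
    and "\<And>s. 1 < length s \<Longrightarrow> Diff coarse_cohomology_complex m b s = 0"
    and "\<And>s. Suc q < length s \<Longrightarrow> b s = 0"
  shows "\<exists>e\<in>coboundaries coarse_cohomology_complex m. \<forall>s. 1 < length s \<longrightarrow> (b - e) s = 0"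
  using assms
proof (induction q arbitrary: b)
  case 0
  have "0 \<in> coboundaries coarse_cohomology_complex m"
    by (rule zero_coboundary[OF cochain_complex_coarse])
  then show ?case
    using 0(3) by (intro bexI[of _ 0]) simp_all
next
  case (Suc q)
  let ?C = "coarse_cohomology_complex :: (('a \<times> 'a) set list \<Rightarrow> 'a list \<Rightarrow> 'b) complex_of_groups"
  have sub: "additive_subgroup (coboundaries ?C m)"
    by (rule additive_subgroup_coboundaries[OF cochain_complex_coarse])
  show ?case
  proof (cases m)
    case 0
    have "b s = 0" if "1 < length s" for s
    proof (rule ext)
      fix xs
      have "\<not> cell (m + 2) s xs"
        using that 0 by (cases xs) (auto simp: cell_def)
      then show "b s xs = 0 xs"
        using Coch_coarseD(1)[OF Suc.prems(1)] by simp
    qed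
    then show ?thesis
      using zero_coboundary[OF cochain_complex_coarse] by (intro bexI[of _ 0]) simp_all
  next
    case (Suc k)
    let ?e = "Diff ?C k (contraction k b)"
    have bk: "b \<in> Coch ?C (Suc k)"
      using Suc.prems(1) Suc by simp
    have e: "?e \<in> coboundaries ?C m"
      using coboundary_Suc[OF contraction_in_Coch[OF bk]] Suc by simp
    have be: "b - ?e \<in> Coch ?C m"
      by (rule Coch_coarse_diff[OF Suc.prems(1) coboundary_coarse(1)[OF e]])
    have Dbe: "Diff ?C m (b - ?e) = Diff ?C m b"
      using coboundary_coarse(2)[OF e] Diff_coarse_diff[OF Suc.prems(1) coboundary_coarse(1)[OF e]] by simp
    have "Diff ?C m (b - ?e) s = 0" if "1 < length s" for s
      unfolding Dbe by (rule Suc.prems(2)[OF that])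
    moreover have "(b - ?e) s = 0" if "Suc q < length s" for s
    proof (rule contraction_top[OF bk _ _ that])
      show "Diff ?C (Suc k) b s = 0" if "1 < length s" for s
        using Suc.prems(2)[OF that] unfolding \<open>m = Suc k\<close> .
      show "b s = 0" if "Suc (Suc q) < length s" for s
        by (rule Suc.prems(3)[OF that])
    qed
    ultimately obtain e' where e': "e' \<in> coboundaries ?C m" "\<And>s. 1 < length s \<Longrightarrow> (b - ?e - e') s = 0"
      using Suc.IH[OF be] by blast
    have eq: "b - (?e + e') = b - ?e - e'"
      by (rule diff_diff_eq[symmetric])
    show ?thesis
    proof (rule bexI[of _ "?e + e'"])
      show "\<forall>s. 1 < length s \<longrightarrow> (b - (?e + e')) s = 0"
        unfolding eq using e'(2) by blast
      show "?e + e' \<in> coboundaries ?C m"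
        by (rule additive_subgroup_add[OF sub e e'(1)])
    qed
  qed
qed

section \<open>The comparison map\<close>

lemma roe_comparison_apply:
  "roe_comparison m a s xs =
    (if length s = 1 \<and> hd s \<in> full_entourages \<and> xs \<in> controlled_tuples (hd s) m then a xs else 0)"
  by (simp add: roe_comparison_def holim_lift_def restrict_tuples_def)

lemma cell_single:
  assumes "length s = 1"
  shows "cell (m + 2) s xs \<longleftrightarrow> hd s \<in> full_entourages \<and> xs \<in> controlled_tuples (hd s) m"
proof -
  obtain U where "s = [U]"
    using assms by (auto simp: length_Suc_conv)
  then show ?thesis
    by (auto simp: cell_def controlled_tuples_iff tuples_def chain_list_def)
qed

lemma roe_comparison_cell:
  "roe_comparison m a s xs = (if length s = 1 \<and> cell (m + 2) s xs then a xs else 0)"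
  using cell_single[of s m xs] by (auto simp: roe_comparison_apply)

lemma roe_comparison_in_Coch:
  assumes a: "a \<in> limit_coch m"
  shows "roe_comparison m a \<in> Coch coarse_cohomology_complex m"
proof -
  have "bounded_support (roe_comparison m a s)" for s
  proof (cases "length s = 1 \<and> hd s \<in> full_entourages")
    case True
    then obtain r where r: "r > 0" "hd s \<subseteq> strip r"
      by (auto simp: full_entourages_def entourages_def)
    show ?thesis
    proof (rule bounded_support_dominated_same[of "{()}" "\<lambda>_. restrict_tuples (controlled_tuples (strip r) m) a"])
      show "bounded_support (restrict_tuples (controlled_tuples (strip r) m) a)"
        using a r by (simp add: limit_coch_def)
      fix xs assume "roe_comparison m a s xs \<noteq> 0"
      then have "xs \<in> controlled_tuples (hd s) m" "a xs \<noteq> 0"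
        by (auto simp: roe_comparison_apply split: if_splits)
      then show "set xs \<subseteq> M \<and> (\<exists>j\<in>{()}. restrict_tuples (controlled_tuples (strip r) m) a xs \<noteq> 0)"
        using r by (auto simp: controlled_tuples_iff restrict_tuples_def tuples_def)
    qed simp
  next
    case False
    then have "roe_comparison m a s = 0"
      by (auto simp: roe_comparison_apply)
    then show ?thesis
      by simp
  qed
  then show ?thesis
    by (simp add: Coch_coarse roe_comparison_cell)
qed

lemma roe_comparison_add: "roe_comparison m (a + b) = roe_comparison m a + roe_comparison m b"
  by (auto simp: fun_eq_iff roe_comparison_apply)

lemma roe_comparison_diff: "roe_comparison m (a - b) = roe_comparison m a - roe_comparison m b"
  by (auto simp: fun_eq_iff roe_comparison_apply)

lemma roe_comparison_Diff:
  assumes a: "a \<in> limit_coch m"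
  shows "Diff coarse_cohomology_complex m (roe_comparison m a) =
    roe_comparison (Suc m) (tuple_diff (tuples (Suc m)) m a)"
proof (intro ext)
  fix s xs
  let ?c = "roe_comparison m a"
  have c: "?c \<in> Coch coarse_cohomology_complex m"
    by (rule roe_comparison_in_Coch[OF a])
  show "Diff coarse_cohomology_complex m ?c s xs =
    roe_comparison (Suc m) (tuple_diff (tuples (Suc m)) m a) s xs"
  proof (cases "cell (Suc m + 2) s xs")
    case False
    then show ?thesis
      by (simp add: Diff_coarse[OF c] roe_comparison_cell eval_nat_numeral)
  next
    case cell: True
    then have D: "Diff coarse_cohomology_complex m ?c s xs = total_diff ?c s xs"
      by (simp add: Diff_coarse[OF c] eval_nat_numeral)
    consider "length s = 1" | "length s = 2" | "2 < length s"
      using cellD(5)[OF cell] by (cases s; cases "tl s"; cases "tl (tl s)") auto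
    then show ?thesis
    proof cases
      case 1
      then obtain U where U: "s = [U]"
        by (auto simp: length_Suc_conv)
      have xs: "xs \<in> tuples (Suc m)" "1 < length xs"
        using cell U by (auto simp: cell_def tuples_def)
      have "face_sum (?c s) xs = face_sum a xs"
      proof (rule face_sum_cong)
        fix i assume "i < length xs"
        then have "cell (m + 2) s (omit i xs)"
          using cell xs by (intro cell_omit_tuple) auto
        then show "?c s (omit i xs) = a (omit i xs)"
          using 1 by (simp add: roe_comparison_cell)
      qed
      moreover have "face_sum (\<lambda>t. ?c t xs) s = 0"
        using Coch_coarseD(3)[OF c] U by (simp add: face_sum_Cons)
      ultimately show ?thesis
        using xs cell 1 D by (simp add: total_diff_def roe_comparison_cell tuple_diff_eq)
    next
      case 2
      then obtain U V where s: "s = [U, V]"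
        by (auto simp: length_Suc_conv numeral_2_eq_2)
      have "cell (m + 2) [U] xs" "cell (m + 2) [V] xs"
        using cell_omit_chain[of "m + 2" s xs 1] cell_omit_chain[of "m + 2" s xs 0] cell s by simp_all
      then have "face_sum (\<lambda>t. ?c t xs) s = 0"
        by (simp add: s face_sum_Cons roe_comparison_cell)
      moreover have "face_sum (?c s) xs = 0"
        by (simp add: face_sum_def roe_comparison_cell 2)
      ultimately show ?thesis
        using D 2 by (simp add: total_diff_def roe_comparison_cell)
    next
      case 3
      have "face_sum (\<lambda>t. ?c t xs) s = face_sum (\<lambda>t. 0) s"
        by (intro face_sum_cong) (use 3 in \<open>auto simp: roe_comparison_cell length_omit\<close>)
      moreover have "face_sum (?c s) xs = 0"
        using 3 by (simp add: face_sum_def roe_comparison_cell)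
      ultimately show ?thesis
        using D 3 by (simp add: total_diff_def roe_comparison_cell)
    qed
  qed
qed

text \<open>Every tuple is controlled by some strip.\<close>

lemma roe_comparison_inj:
  assumes "a \<in> limit_coch m" "b \<in> limit_coch m" "roe_comparison m a = roe_comparison m b"
  shows "a = b"
proof (rule ext)
  fix xs
  show "a xs = b xs"
  proof (cases "xs \<in> tuples m")
    case True
    then have "xs \<in> controlled_tuples (strip_hull (pairs xs)) m"
      using strip_hull_upper[OF pairs_entourage] by (simp add: controlled_tuples_iff tuplesD)
    then show ?thesis
      using fun_cong[OF fun_cong[OF assms(3)], of "[strip_hull (pairs xs)]" xs] strip_hull_full
      by (simp add: roe_comparison_apply)
  next
    case False
    then show ?thesis
      using assms by (simp add: limit_coch_def)
  qed
qed

text \<open>For chains with one entry, \<open>cone_homotopy\<close> says that the value at \<open>xs\<close> is that on the hull of the pairs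
  of \<open>xs\<close>, whatever the entourage. These values form a cochain on all tuples.\<close>

lemma concentrated_cochain_is_limit:
  assumes b: "b \<in> Coch coarse_cohomology_complex m"
    and Db: "\<And>s. 1 < length s \<Longrightarrow> Diff coarse_cohomology_complex m b s = 0"
    and conc: "\<And>s. 1 < length s \<Longrightarrow> b s = 0"
  shows "\<exists>a\<in>limit_coch m. b = roe_comparison m a"
proof -
  define a where "a = restrict_tuples (tuples m) (\<lambda>xs. b [strip_hull (pairs xs)] xs)"
  have closed: "face_sum (\<lambda>u. b u xs) t = 0" if "cell (m + 3) t xs" "1 < length t" for t xs
  proof -
    have "Diff coarse_cohomology_complex m b t xs =
      face_sum (\<lambda>u. b u xs) t + alt (length t - 1) (face_sum (b t) xs)"
      using that(1) by (simp add: Diff_coarse[OF b] total_diff_def)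
    then show ?thesis
      using Db[OF that(2)] conc[OF that(2)] by simp
  qed
  have key: "b s xs = a xs" if cell: "cell (m + 2) s xs" and s: "length s = 1" for s xs
  proof -
    obtain U where U: "s = [U]"
      using s by (auto simp: length_Suc_conv)
    have "b s xs = face_sum (cone_homotopy xs (\<lambda>u. b u xs)) s"
    proof (rule cone_homotopy[OF _ cell])
      fix t assume t: "cell (Suc (m + 2)) t xs"
      then show "face_sum (\<lambda>u. b u xs) t = 0"
        using cellD(6)[OF t] cellD(6)[OF cell] s by (intro closed) (simp_all add: eval_nat_numeral)
    qed
    then have "b s xs = b [strip_hull (pairs xs)] xs"
      by (simp add: U face_sum_Cons cone_homotopy_def)
    moreover have "xs \<in> tuples m"
      using cell_single[OF s] cell by (simp add: controlled_tuples_iff)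
    ultimately show ?thesis
      by (simp add: a_def restrict_tuples_def)
  qed
  have "b s xs = roe_comparison m a s xs" for s xs
  proof (cases "cell (m + 2) s xs")
    case True
    then have "length s = 1 \<or> 1 < length s"
      using cellD(5)[OF True] by (cases s) auto
    then show ?thesis
      using key[OF True] conc True by (auto simp: roe_comparison_cell)
  qed (simp add: roe_comparison_cell Coch_coarseD(1)[OF b])
  then have "b = roe_comparison m a"
    by (intro ext)
  moreover have "bounded_support (restrict_tuples (controlled_tuples (strip r) m) a)" if r: "r > 0" for r
  proof -
    have "restrict_tuples (controlled_tuples (strip r) m) a = b [strip r]"
    proof (rule ext)
      fix xs
      have "cell (m + 2) [strip r] xs \<longleftrightarrow> xs \<in> controlled_tuples (strip r) m"
        using cell_single[of "[strip r]" m xs] strip_full[OF r] by simp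
      then show "restrict_tuples (controlled_tuples (strip r) m) a xs = b [strip r] xs"
        using key[of "[strip r]" xs] Coch_coarseD(1)[OF b, of "[strip r]" xs] by (simp add: restrict_tuples_def)
    qed
    then show ?thesis
      using Coch_coarseD(2)[OF b] by simp
  qed
  then have "a \<in> limit_coch m"
    by (simp add: limit_coch_def) (simp add: a_def restrict_tuples_def)
  ultimately show ?thesis
    by blast
qed

theorem quasi_isomorphism_roe_comparison:
  assumes proper: proper_metric
  shows "quasi_isomorphism
    (roe_comparison :: nat \<Rightarrow> ('a list \<Rightarrow> 'b::ab_group_add) \<Rightarrow> (('a \<times> 'a) set list \<Rightarrow> 'a list \<Rightarrow> 'b))
    roe_complex coarse_cohomology_complex"
proof (rule quasi_isomorphismI[OF cochain_complex_roe[OF proper] cochain_complex_coarse])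
  let ?R = "roe_complex :: ('a list \<Rightarrow> 'b) complex_of_groups"
  let ?C = "coarse_cohomology_complex :: (('a \<times> 'a) set list \<Rightarrow> 'a list \<Rightarrow> 'b) complex_of_groups"
  have limit: "a \<in> limit_coch m" if "a \<in> Coch ?R m" for a m
    using that by (simp add: Coch_roe_complex[OF proper])
  show "cochain_map roe_comparison ?R ?C"
    unfolding cochain_map_def Diff_roe_complex
  proof (intro allI conjI ballI image_subsetI)
    show "roe_comparison m a \<in> Coch ?C m" if "a \<in> Coch ?R m" for m a
      by (rule roe_comparison_in_Coch[OF limit[OF that]])
    show "roe_comparison m (a + b) = roe_comparison m a + roe_comparison m b" for m and a b :: "'a list \<Rightarrow> 'b"
      by (rule roe_comparison_add)
    show "roe_comparison (Suc m) (tuple_diff (tuples (Suc m)) m a) = Diff ?C m (roe_comparison m a)"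
      if "a \<in> Coch ?R m" for m a
      by (rule roe_comparison_Diff[OF limit[OF that], symmetric])
  qed
  have zero: "(0 :: 'a list \<Rightarrow> 'b) \<in> limit_coch m" "roe_comparison m (0 :: 'a list \<Rightarrow> 'b) = 0" for m
  proof -
    have "0 \<in> Coch ?R m"
      using cochain_complex_roe[OF proper, where ?'b = 'b] by (simp add: cochain_complex_def additive_subgroup_def)
    then show "(0 :: 'a list \<Rightarrow> 'b) \<in> limit_coch m"
      by (rule limit)
    show "roe_comparison m (0 :: 'a list \<Rightarrow> 'b) = 0"
      by (auto simp: fun_eq_iff roe_comparison_apply)
  qed
  show "a = 0" if "a \<in> Coch ?R m" "roe_comparison m a = 0" for m a
    using roe_comparison_inj[OF limit[OF that(1)] zero(1)] that(2) zero(2) by simp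
  fix m b a
  assume b: "b \<in> Coch ?C m" and a: "a \<in> Coch ?R (Suc m)" and Db: "Diff ?C m b = roe_comparison (Suc m) a"
  have Db0: "Diff ?C m b s = 0" if "1 < length s" for s
    using that by (auto simp: Db fun_eq_iff roe_comparison_apply)
  have "b s = 0" if "Suc m < length s" for s
  proof (rule ext)
    fix xs
    have "\<not> cell (m + 2) s xs"
      using that by (cases xs) (auto simp: cell_def)
    then show "b s xs = 0 xs"
      using Coch_coarseD(1)[OF b] by simp
  qed
  then obtain e where e: "e \<in> coboundaries ?C m" "\<And>s. 1 < length s \<Longrightarrow> (b - e) s = 0"
    using staircase[OF b Db0] by blast
  have be: "b - e \<in> Coch ?C m" "Diff ?C m (b - e) = Diff ?C m b"
    using Coch_coarse_diff[OF b] Diff_coarse_diff[OF b] coboundary_coarse[OF e(1)] by simp_all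
  then obtain \<phi> where \<phi>: "\<phi> \<in> limit_coch m" "b - e = roe_comparison m \<phi>"
    using concentrated_cochain_is_limit[OF be(1)] Db0 e(2) by metis
  have "roe_comparison (Suc m) (tuple_diff (tuples (Suc m)) m \<phi>) = roe_comparison (Suc m) a"
    using roe_comparison_Diff[OF \<phi>(1)] \<phi>(2) be(2) Db by simp
  then have "tuple_diff (tuples (Suc m)) m \<phi> = a"
    by (rule roe_comparison_inj[OF limit_coch_tuple_diff[OF \<phi>(1)] limit[OF a]])
  then have "tuple_diff (tuples (Suc m)) m \<phi> \<in> Coch ?R (Suc m)"
    using a by simp
  then obtain \<phi>' where \<phi>': "\<phi>' \<in> Coch ?R m"
    "case m of 0 \<Rightarrow> \<phi> = \<phi>' | Suc k \<Rightarrow> \<exists>\<epsilon>\<in>limit_coch k. \<phi> - \<phi>' = tuple_diff (tuples m) k \<epsilon>"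
    by (rule roe_approximation[OF proper \<phi>(1)])
  have "roe_comparison m \<phi> - roe_comparison m \<phi>' \<in> coboundaries ?C m"
  proof (cases m)
    case 0
    then show ?thesis
      using \<phi>'(2) by (simp add: coboundaries_def)
  next
    case (Suc k)
    then obtain \<epsilon> where \<epsilon>: "\<epsilon> \<in> limit_coch k" "\<phi> - \<phi>' = tuple_diff (tuples (Suc k)) k \<epsilon>"
      using \<phi>'(2) by auto
    have "roe_comparison m \<phi> - roe_comparison m \<phi>' = Diff ?C k (roe_comparison k \<epsilon>)"
      using roe_comparison_Diff[OF \<epsilon>(1)] \<epsilon>(2) Suc by (simp flip: roe_comparison_diff)
    then show ?thesis
      using coboundary_Suc[OF roe_comparison_in_Coch[OF \<epsilon>(1)]] Suc by simp
  qed
  then have "e + (roe_comparison m \<phi> - roe_comparison m \<phi>') \<in> coboundaries ?C m"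
    by (rule additive_subgroup_add[OF additive_subgroup_coboundaries[OF cochain_complex_coarse] e(1)])
  moreover have "e + (roe_comparison m \<phi> - roe_comparison m \<phi>') = b - roe_comparison m \<phi>'"
    using \<phi>(2) by (simp add: algebra_simps)
  ultimately show "\<exists>a'\<in>Coch ?R m. b - roe_comparison m a' \<in> coboundaries ?C m"
    using \<phi>'(1) by auto
qed

end

theorem lemma3p12:
  fixes X :: "'x set" and d :: "'x \<Rightarrow> 'x \<Rightarrow> real"
  assumes "Metric_space X d"
    and "Metric_space.proper_metric X d"
  shows "quasi_isomorphism
           (Metric_space.roe_comparison X d ::
              nat \<Rightarrow> ('x list \<Rightarrow> 'a::ab_group_add) \<Rightarrow> (('x \<times> 'x) set list \<Rightarrow> 'x list \<Rightarrow> 'a))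
           (Metric_space.roe_complex X d)
           (Metric_space.coarse_cohomology_complex X d)"
  using Metric_space.quasi_isomorphism_roe_comparison[OF assms] .

end
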